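(* Let the domain $\Omega$ be partitioned into non-overlapping cells $\{\Omega^{c}\}_{c=1}^{N_C}$, and for each cell $c$ let $\mathsf{M}^{c},\mathsf{Q}_x^{c}\in\mathbb{R}^{N^{c}\times N^{c}}$ be a degree $p$, degenerate summation-by-parts (SBP) pair on $\Omega^c$ at the cell's stencil nodes $X^c$, with $\mathsf{Q}_x^{c}=\mathsf{S}_x^{c}+\frac12\mathsf{E}_x^{c}$, $\mathsf{S}_x^c$ skew symmetric, and $$\mathsf{E}_x^{c}=\sum_{f\in F^{c}}\big[\mathsf{R}^{f,c}\big]^T\,\mathsf{B}^{f}\,\mathsf{N}_x^{f,c}\,\mathsf{R}^{f,c}.$$ Define $$\mathsf{M}\equiv\sum_{c=1}^{N_C}(\mathsf{P}^{c})^T\,\mathsf{M}^{c}\,\mathsf{P}^{c},\qquad \mathsf{E}_x\equiv\sum_{f\in F_B}\big(\mathsf{R}^{f}\big)^T\,\mathsf{B}^{f}\,\mathsf{N}_x^{f}\,\mathsf{R}^{f},$$ $$\mathsf{S}_x\equiv\sum_{c=1}^{N_C}(\mathsf{P}^{c})^T\,\mathsf{S}_x^{c}\,\mathsf{P}^{c}+\frac12\sum_{f\in F_I}\big(\mathsf{R}^{f,-}\big)^T\,\mathsf{B}^{f}\,\mathsf{N}_x^{f}\,\mathsf{R}^{f,+}-\frac12\sum_{f\in F_I}\big(\mathsf{R}^{f,+}\big)^T\,\mathsf{B}^{f}\,\mathsf{N}_x^{f}\,\mathsf{R}^{f,-}.$$ Then $\mathsf{M}$ and $\mathsf{Q}_x\equiv\mathsf{S}_x+\frac12\mathsf{E}_x$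 form a degree $p$, degenerate SBP pair on $\Omega$ at the global node set $X$.
   Context: Polynomials and Vandermonde matrices. $\Omega\subset\mathbb{R}^d$ is a bounded domain with boundary $\Gamma$; $x$ denotes the first Cartesian coordinate. $\mathbb{P}^p$ is the space of polynomials of total degree at most $p$ (with $p\ge1$), of dimension $N_{p,d}=\binom{p+d}{d}$, with basis $\{\mathcal{V}_j\}$. For a node set $X=\{\boldsymbol{x}_i\}_{i=1}^N$, $[\mathsf{V}]_{ij}=\mathcal{V}_j(\boldsymbol{x}_i)$ and $[\mathsf{V}_x]_{ij}=\frac{\partial\mathcal{V}_j}{\partial x}(\boldsymbol{x}_i)$. Degenerate SBP pair. Matrices $\mathsf{M},\mathsf{Q}_x\in\mathbb{R}^{N\times N}$ form a degree $p$, degenerate SBP pair for $\partial/\partial x$ on a domain $\Omega$ with boundary $\Gamma$ at the nodes $X=\{\boldsymbol{x}_i\}_{i=1}^N$ if: (1) $\mathsf{Q}_x\mathsf{V}=\mathsf{M}\mathsf{V}_x$; (2) $\mathsf{M}$ is diagonal (not necessarily positive definite) and $\mathsf{Q}_x=\mathsf{S}_x+\frac12\mathsf{E}_x$ with $\mathsf{S}_x$ skew symmetric and $\mathsf{E}_x$ symmetric; (3) $[\mathsf{V}^T\mathsf{E}_x\mathsf{V}]_{ij}=\int_\Gamma\mathcal{V}_i\mathcal{V}_j\,n_x\,d\Gamma$ for all $i,j$, where $n_x$ is the $x$ component of the outward unit normal on $\Gamma$. (Nodes need not lie in the domain. For cell $c$, the definition is applied with $\Omega^c$, $\partial\Omega^c$,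 $X^c$ in place of $\Omega$, $\Gamma$, $X$.) Mesh and stencils. The mesh has faces $\{\Gamma^f\}_{f=1}^{N_F}$. $F^c$ is the set of faces forming the boundary of cell $c$; $F_I$ is the set of interfaces, each shared by exactly two adjacent cells; $F_B$ is the set of boundary faces, which make up $\Gamma$ and are each adjacent to exactly one cell. The mesh is a Cartesian cut-cell mesh, so each interface in $F_I$ is perpendicular to one of the coordinate axes. The global nodes are $X=\{\boldsymbol{x}_i\}_{i=1}^N$. Each cell $c$ has a stencil $\mathsf{nodes}(c)=\{\nu_1,\dots,\nu_{N^c}\}\subset\{1,\dots,N\}$ and nodes $X^c=\{\boldsymbol{x}_i: i\in\mathsf{nodes}(c)\}$. $\mathsf{P}^c\in\mathbb{R}^{N^c\times N}$ is the binary matrix with $[\mathsf{P}^c]_{ij}=1$ if $j=\nu_i$ and $0$ otherwise. $\mathsf{V}^c=\mathsf{P}^c\mathsf{V}$ is the degree $p$ Vandermonde matrix at $X^c$; it has full column rank. Face operators. Each face $f$ has a quadrature rule with positive weights that is exact for polynomials of degree $2p$ on $\Gamma^f$. $\mathsf{B}^f$ is the diagonal matrix of its weights. $\mathsf{N}_x^{f,c}$ is the diagonal matrix holding the $x$ components, at the quadrature nodes of $f$, of the unit normal on $f$ that is outward with respect to cell $c$. $\mathsf{R}^{f,c}=\mathsf{V}^f[\mathsf{V}^c]^\dagger$, where $\mathsf{V}^f$ is the matrix of degree $p$ basis polynomials evaluated at the quadrature nodes of $f$ and $\dagger$ is the Moore–Penrose pseudoinverse; thus $\mathsf{R}^{f,c}$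 interpolates degree $p$ polynomials exactly from $X^c$ to the quadrature nodes of $f$. For $f\in F_B$ with adjacent cell $c$: $\mathsf{R}^f=\mathsf{R}^{f,c}\mathsf{P}^c$ and $\mathsf{N}_x^f=\mathsf{N}_x^{f,c}$. For $f\in F_I$, let $c^-$ and $c^+$ be the adjacent cells on the negative and positive side of $f$ with respect to the coordinate direction perpendicular to $f$; then $\mathsf{R}^{f,-}=\mathsf{R}^{f,c^-}\mathsf{P}^{c^-}$, $\mathsf{R}^{f,+}=\mathsf{R}^{f,c^+}\mathsf{P}^{c^+}$, and $\mathsf{N}_x^f=\mathsf{N}_x^{f,c^-}=-\mathsf{N}_x^{f,c^+}$, i.e. $\mathsf{N}_x^f$ is taken with the sign making its diagonal entries nonnegative. *)

theory Defs
  imports "HOL-Analysis.Analysis" "Jordan_Normal_Form.DL_Rank"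
begin

no_notation vec_index (infixl "$" 100)
no_notation scalar_prod (infix "\<bullet>" 70)

section \<open>Surface measure and normals\<close>

text \<open>
  The Hausdorff measure carries its usual normalisation by the volume of the unit ball, so that in
  dimension \<open>CARD('d) - 1\<close> it is the ordinary surface area. For \<open>k = 0\<close> the convention \<open>0 ^ 0 = 1\<close>
  makes every nonempty covering set count \<open>1\<close>, and one obtains the counting measure.
\<close>

definition hausdorff_premeasure :: "nat \<Rightarrow> real \<Rightarrow> 'a::metric_space set \<Rightarrow> ennreal" where
  "hausdorff_premeasure k \<delta> A =
     (INF U \<in> {U :: nat \<Rightarrow> 'a set. A \<subseteq> (\<Union>i. U i) \<and> (\<forall>i. bounded (U i) \<and> diameter (U i) \<le> \<delta>)}.
        \<Sum>i. if U i = {} then 0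
             else ennreal (unit_ball_vol (real k) * (diameter (U i) / 2) ^ k))"

definition hausdorff_outer_measure :: "nat \<Rightarrow> 'a::metric_space set \<Rightarrow> ennreal" where
  "hausdorff_outer_measure k A = (SUP \<delta> \<in> {0<..}. hausdorff_premeasure k \<delta> A)"

text \<open>
  The Hausdorff outer measure is a metric outer measure, hence countably additive on Borel sets,
  so \<open>measure_of\<close> does not fall back to the zero measure here.
\<close>

definition surface_measure :: "(real ^ 'd::finite) measure" where
  "surface_measure = measure_of UNIV (sets borel) (hausdorff_outer_measure (CARD('d) - 1))"

text \<open>
  Pointwise outward unit normal: near \<open>x\<close>, and outside arbitrarily thin cones around the hyperplane
  through \<open>x\<close> orthogonal to \<open>\<nu>\<close>, the set \<open>A\<close> fills the half space behind \<open>\<nu>\<close> and misses the half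
  space in front of it. Such a \<open>\<nu>\<close> is unique, and it is the usual normal wherever \<open>A\<close> lies locally
  on one side of a \<open>C\<^sup>1\<close> hypersurface.
\<close>

definition is_outward_unit_normal ::
  "(real ^ 'd::finite) set \<Rightarrow> real ^ 'd \<Rightarrow> real ^ 'd \<Rightarrow> bool" where
  "is_outward_unit_normal A x \<nu> \<longleftrightarrow>
     norm \<nu> = 1 \<and>
     (\<forall>\<epsilon>>0. \<exists>\<delta>>0. \<forall>y. dist y x < \<delta> \<longrightarrow>
        ((y - x) \<bullet> \<nu> < - \<epsilon> * norm (y - x) \<longrightarrow> y \<in> A) \<and>
        ((y - x) \<bullet> \<nu> > \<epsilon> * norm (y - x) \<longrightarrow> y \<notin> A))"

definition outward_unit_normal :: "(real ^ 'd::finite) set \<Rightarrow> real ^ 'd \<Rightarrow> real ^ 'd" where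
  "outward_unit_normal A x =
     (if \<exists>\<nu>. is_outward_unit_normal A x \<nu> then THE \<nu>. is_outward_unit_normal A x \<nu> else 0)"

definition regular_boundary :: "(real ^ 'd::finite) set \<Rightarrow> bool" where
  "regular_boundary A \<longleftrightarrow>
     emeasure surface_measure (frontier A) < \<infinity> \<and>
     (AE x in surface_measure. x \<in> frontier A \<longrightarrow> (\<exists>\<nu>. is_outward_unit_normal A x \<nu>))"

text \<open>
  A quadrature node may lie on the edge of a face \<open>S\<close>, where the cell \<open>A\<close> itself need not have a
  normal. The normal on the face is therefore the limit of the normals of \<open>A\<close> at points of \<open>S\<close>.
  The filter does not exclude \<open>x\<close>, so this is the normal of \<open>A\<close> at \<open>x\<close> wherever that exists.
\<close>

definition face_normal_filter ::
  "(real ^ 'd::finite) set \<Rightarrow> (real ^ 'd) set \<Rightarrow> real ^ 'd \<Rightarrow> (real ^ 'd) filter" where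
  "face_normal_filter A S x =
     inf (nhds x) (principal {y \<in> S. \<exists>\<nu>. is_outward_unit_normal A y \<nu>})"

definition has_face_normal ::
  "(real ^ 'd::finite) set \<Rightarrow> (real ^ 'd) set \<Rightarrow> real ^ 'd \<Rightarrow> bool" where
  "has_face_normal A S x \<longleftrightarrow>
     face_normal_filter A S x \<noteq> bot \<and>
     (\<exists>\<nu>. (outward_unit_normal A \<longlongrightarrow> \<nu>) (face_normal_filter A S x))"

definition face_normal ::
  "(real ^ 'd::finite) set \<Rightarrow> (real ^ 'd) set \<Rightarrow> real ^ 'd \<Rightarrow> real ^ 'd" where
  "face_normal A S x = Lim (face_normal_filter A S x) (outward_unit_normal A)"


section \<open>Polynomials and Vandermonde matrices\<close>

definition poly_space :: "nat \<Rightarrow> (real ^ 'd::finite \<Rightarrow> real) set" where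
  "poly_space p =
     {q. \<exists>c. \<forall>x. q x = (\<Sum>\<alpha> | (\<Sum>i\<in>UNIV. \<alpha> i) \<le> p. c \<alpha> * (\<Prod>i\<in>UNIV. x $ i ^ \<alpha> i))}"

definition poly_dim :: "'d::finite itself \<Rightarrow> nat \<Rightarrow> nat" where
  "poly_dim _ p = (p + CARD('d)) choose CARD('d)"

definition poly_basis :: "nat \<Rightarrow> (nat \<Rightarrow> real ^ 'd::finite \<Rightarrow> real) \<Rightarrow> bool" where
  "poly_basis p V \<longleftrightarrow>
     (\<forall>j < poly_dim TYPE('d) p. V j \<in> poly_space p) \<and>
     (\<forall>c. (\<forall>x. (\<Sum>j < poly_dim TYPE('d) p. c j * V j x) = 0) \<longrightarrow>
          (\<forall>j < poly_dim TYPE('d) p. c j = 0)) \<and>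
     (\<forall>q \<in> poly_space p. \<exists>c. \<forall>x. q x = (\<Sum>j < poly_dim TYPE('d) p. c j * V j x))"

definition vandermonde ::
  "nat \<Rightarrow> (nat \<Rightarrow> real ^ 'd::finite \<Rightarrow> real) \<Rightarrow> nat \<Rightarrow> (nat \<Rightarrow> real ^ 'd) \<Rightarrow> real mat" where
  "vandermonde p V m x = Matrix.mat m (poly_dim TYPE('d) p) (\<lambda>(i, j). V j (x i))"

definition vandermonde_deriv ::
  "'d \<Rightarrow> nat \<Rightarrow> (nat \<Rightarrow> real ^ 'd::finite \<Rightarrow> real) \<Rightarrow> nat \<Rightarrow> (nat \<Rightarrow> real ^ 'd) \<Rightarrow> real mat" where
  "vandermonde_deriv k p V m x =
     Matrix.mat m (poly_dim TYPE('d) p)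
       (\<lambda>(i, j). frechet_derivative (V j) (at (x i)) (axis k 1))"


section \<open>Matrices\<close>

definition mat_sum :: "nat \<Rightarrow> nat \<Rightarrow> ('i \<Rightarrow> real mat) \<Rightarrow> 'i set \<Rightarrow> real mat" where
  "mat_sum m n A I = Matrix.mat m n (\<lambda>ij. \<Sum>a\<in>I. A a $$ ij)"

definition is_pseudoinverse :: "real mat \<Rightarrow> real mat \<Rightarrow> bool" where
  "is_pseudoinverse A B \<longleftrightarrow>
     B \<in> carrier_mat (dim_col A) (dim_row A) \<and>
     A * B * A = A \<and> B * A * B = B \<and> (A * B)\<^sup>T = A * B \<and> (B * A)\<^sup>T = B * A"

definition pseudoinverse :: "real mat \<Rightarrow> real mat" where
  "pseudoinverse A = (THE B. is_pseudoinverse A B)"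

definition full_column_rank :: "real mat \<Rightarrow> bool" where
  "full_column_rank A \<longleftrightarrow> vec_space.rank (dim_row A) A = dim_col A"

definition symmetric_mat :: "real mat \<Rightarrow> bool" where
  "symmetric_mat A \<longleftrightarrow> A\<^sup>T = A"

definition skew_symmetric_mat :: "real mat \<Rightarrow> bool" where
  "skew_symmetric_mat A \<longleftrightarrow> A\<^sup>T = - A"


section \<open>Degenerate summation-by-parts pairs\<close>

text \<open>
  The index \<open>k\<close> is the coordinate in which one differentiates. The decomposition \<open>Q = S + E / 2\<close>
  is unique, being that of \<open>Q\<close> into its skew symmetric and symmetric parts.
\<close>

definition degenerate_SBP_pair ::
  "'d \<Rightarrow> nat \<Rightarrow> (nat \<Rightarrow> real ^ 'd::finite \<Rightarrow> real) \<Rightarrow> (real ^ 'd) set \<Rightarrow>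
   nat \<Rightarrow> (nat \<Rightarrow> real ^ 'd) \<Rightarrow> real mat \<Rightarrow> real mat \<Rightarrow> bool" where
  "degenerate_SBP_pair k p V A m x M Q \<longleftrightarrow>
     M \<in> carrier_mat m m \<and> Q \<in> carrier_mat m m \<and>
     Q * vandermonde p V m x = M * vandermonde_deriv k p V m x \<and>
     diagonal_mat M \<and>
     (\<exists>S \<in> carrier_mat m m. \<exists>E \<in> carrier_mat m m.
        Q = S + (1 / 2) \<cdot>\<^sub>m E \<and> skew_symmetric_mat S \<and> symmetric_mat E \<and>
        (\<forall>i < poly_dim TYPE('d) p. \<forall>j < poly_dim TYPE('d) p.
           ((vandermonde p V m x)\<^sup>T * E * vandermonde p V m x) $$ (i, j) =
           (LINT y:frontier A|surface_measure. V i y * V j y * outward_unit_normal A y $ k)))"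


section \<open>Cut-cell meshes\<close>

text \<open>
  Cells, faces and nodes are numbered from \<open>0\<close>. The fields \<open>neg_cell\<close> and \<open>pos_cell\<close> are meaningful
  for interfaces only, and \<open>bdry_cell\<close> for boundary faces only.
\<close>

record ('d::finite) cut_mesh =
  omega :: "(real ^ 'd) set"
  n_cells :: nat
  cell :: "nat \<Rightarrow> (real ^ 'd) set"
  n_faces :: nat
  face :: "nat \<Rightarrow> (real ^ 'd) set"
  cell_faces :: "nat \<Rightarrow> nat set"
  interfaces :: "nat set"
  bdry_faces :: "nat set"
  neg_cell :: "nat \<Rightarrow> nat"
  pos_cell :: "nat \<Rightarrow> nat"
  bdry_cell :: "nat \<Rightarrow> nat"

text \<open>
  Cells are open sets and faces are closed sets, so that partitioning \<open>\<Omega>\<close> means that the cells are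
  disjoint and that their closures cover the closure of \<open>\<Omega>\<close>.
\<close>

definition cell_partition :: "('d::finite, 'z) cut_mesh_scheme \<Rightarrow> bool" where
  "cell_partition T \<longleftrightarrow>
     (\<forall>c < n_cells T. open (cell T c) \<and> cell T c \<noteq> {} \<and> cell T c \<subseteq> omega T) \<and>
     (\<forall>c < n_cells T. \<forall>c' < n_cells T. c \<noteq> c' \<longrightarrow> cell T c \<inter> cell T c' = {}) \<and>
     closure (omega T) = (\<Union>c < n_cells T. closure (cell T c))"

definition mesh_faces :: "('d::finite, 'z) cut_mesh_scheme \<Rightarrow> bool" where
  "mesh_faces T \<longleftrightarrow>
     (\<forall>f < n_faces T. closed (face T f)) \<and>
     (\<forall>f < n_faces T. \<forall>g < n_faces T. f \<noteq> g \<longrightarrow>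
        emeasure surface_measure (face T f \<inter> face T g) = 0) \<and>
     (\<forall>c < n_cells T.
        cell_faces T c \<subseteq> {..<n_faces T} \<and>
        frontier (cell T c) = (\<Union>f \<in> cell_faces T c. face T f)) \<and>
     interfaces T \<union> bdry_faces T = {..<n_faces T} \<and>
     interfaces T \<inter> bdry_faces T = {} \<and>
     frontier (omega T) = (\<Union>f \<in> bdry_faces T. face T f) \<and>
     (\<forall>f \<in> bdry_faces T. {c. c < n_cells T \<and> f \<in> cell_faces T c} = {bdry_cell T f})"

text \<open>
  That \<open>neg_cell T f\<close> lies on the negative side of an interface \<open>f\<close> perpendicular to the axis \<open>m\<close>
  means that its outward normal on \<open>f\<close> points in the positive \<open>m\<close>-direction.
\<close>

definition axis_aligned_interfaces :: "('d::finite, 'z) cut_mesh_scheme \<Rightarrow> bool" where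
  "axis_aligned_interfaces T \<longleftrightarrow>
     (\<forall>f \<in> interfaces T.
        neg_cell T f \<noteq> pos_cell T f \<and>
        {c. c < n_cells T \<and> f \<in> cell_faces T c} = {neg_cell T f, pos_cell T f} \<and>
        (\<exists>m. (\<exists>a. \<forall>x \<in> face T f. x $ m = a) \<and>
             (\<forall>x \<in> face T f.
                has_face_normal (cell T (neg_cell T f)) (face T f) x \<and>
                has_face_normal (cell T (pos_cell T f)) (face T f) x \<and>
                face_normal (cell T (neg_cell T f)) (face T f) x = axis m 1 \<and>
                face_normal (cell T (pos_cell T f)) (face T f) x = - axis m 1)))"

definition cut_cell_mesh :: "('d::finite, 'z) cut_mesh_scheme \<Rightarrow> bool" where
  "cut_cell_mesh T \<longleftrightarrow>
     open (omega T) \<and> connected (omega T) \<and> omega T \<noteq> {} \<and> bounded (omega T) \<and>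
     regular_boundary (omega T) \<and> (\<forall>c < n_cells T. regular_boundary (cell T c)) \<and>
     cell_partition T \<and> mesh_faces T \<and> axis_aligned_interfaces T"


section \<open>Global nodes, stencils and face quadratures\<close>

record ('d::finite) sbp_mesh = "'d cut_mesh" +
  n_nodes :: nat
  node :: "nat \<Rightarrow> real ^ 'd"
  stencil :: "nat \<Rightarrow> nat list"
  n_quad :: "nat \<Rightarrow> nat"
  quad_node :: "nat \<Rightarrow> nat \<Rightarrow> real ^ 'd"
  quad_weight :: "nat \<Rightarrow> nat \<Rightarrow> real"

definition stencil_size :: "('d::finite, 'z) sbp_mesh_scheme \<Rightarrow> nat \<Rightarrow> nat" where
  "stencil_size T c = length (stencil T c)"

definition stencil_node :: "('d::finite, 'z) sbp_mesh_scheme \<Rightarrow> nat \<Rightarrow> nat \<Rightarrow> real ^ 'd" where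
  "stencil_node T c i = node T (stencil T c ! i)"

definition valid_stencils ::
  "nat \<Rightarrow> (nat \<Rightarrow> real ^ 'd::finite \<Rightarrow> real) \<Rightarrow> ('d, 'z) sbp_mesh_scheme \<Rightarrow> bool" where
  "valid_stencils p V T \<longleftrightarrow>
     (\<forall>c < n_cells T.
        distinct (stencil T c) \<and> set (stencil T c) \<subseteq> {..<n_nodes T} \<and>
        full_column_rank (vandermonde p V (stencil_size T c) (stencil_node T c)))"

definition valid_quadratures :: "nat \<Rightarrow> ('d::finite, 'z) sbp_mesh_scheme \<Rightarrow> bool" where
  "valid_quadratures p T \<longleftrightarrow>
     (\<forall>f < n_faces T.
        (\<forall>i < n_quad T f. quad_node T f i \<in> face T f \<and> quad_weight T f i > 0) \<and>
        (\<forall>c < n_cells T. f \<in> cell_faces T c \<longrightarrow>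
           (\<forall>i < n_quad T f. has_face_normal (cell T c) (face T f) (quad_node T f i))) \<and>
        (\<forall>q \<in> poly_space (2 * p).
           (\<Sum>i < n_quad T f. quad_weight T f i * q (quad_node T f i)) =
           (LINT y:face T f|surface_measure. q y)))"

definition P_mat :: "('d::finite, 'z) sbp_mesh_scheme \<Rightarrow> nat \<Rightarrow> real mat" where
  "P_mat T c = Matrix.mat (stencil_size T c) (n_nodes T)
                 (\<lambda>(i, j). if j = stencil T c ! i then 1 else 0)"

definition B_mat :: "('d::finite, 'z) sbp_mesh_scheme \<Rightarrow> nat \<Rightarrow> real mat" where
  "B_mat T f = mat_diag (n_quad T f) (quad_weight T f)"

definition N_cell :: "'d \<Rightarrow> ('d::finite, 'z) sbp_mesh_scheme \<Rightarrow> nat \<Rightarrow> nat \<Rightarrow> real mat" where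
  "N_cell k T f c =
     mat_diag (n_quad T f) (\<lambda>i. face_normal (cell T c) (face T f) (quad_node T f i) $ k)"

definition R_cell ::
  "nat \<Rightarrow> (nat \<Rightarrow> real ^ 'd::finite \<Rightarrow> real) \<Rightarrow> ('d, 'z) sbp_mesh_scheme \<Rightarrow> nat \<Rightarrow> nat \<Rightarrow> real mat" where
  "R_cell p V T f c =
     vandermonde p V (n_quad T f) (quad_node T f) *
     pseudoinverse (vandermonde p V (stencil_size T c) (stencil_node T c))"

definition R_bdry ::
  "nat \<Rightarrow> (nat \<Rightarrow> real ^ 'd::finite \<Rightarrow> real) \<Rightarrow> ('d, 'z) sbp_mesh_scheme \<Rightarrow> nat \<Rightarrow> real mat" where
  "R_bdry p V T f = R_cell p V T f (bdry_cell T f) * P_mat T (bdry_cell T f)"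

definition R_neg ::
  "nat \<Rightarrow> (nat \<Rightarrow> real ^ 'd::finite \<Rightarrow> real) \<Rightarrow> ('d, 'z) sbp_mesh_scheme \<Rightarrow> nat \<Rightarrow> real mat" where
  "R_neg p V T f = R_cell p V T f (neg_cell T f) * P_mat T (neg_cell T f)"

definition R_pos ::
  "nat \<Rightarrow> (nat \<Rightarrow> real ^ 'd::finite \<Rightarrow> real) \<Rightarrow> ('d, 'z) sbp_mesh_scheme \<Rightarrow> nat \<Rightarrow> real mat" where
  "R_pos p V T f = R_cell p V T f (pos_cell T f) * P_mat T (pos_cell T f)"

definition N_face :: "'d \<Rightarrow> ('d::finite, 'z) sbp_mesh_scheme \<Rightarrow> nat \<Rightarrow> real mat" where
  "N_face k T f =
     (if f \<in> interfaces T then N_cell k T f (neg_cell T f) else N_cell k T f (bdry_cell T f))"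

end

theory Submission
  imports Defs
begin

text \<open>
  Every property of the global pair is the sum over the cells of the same property of the cell
  pairs, once the face terms have been sorted. Summing a quantity over all cells and over the faces
  of each cell visits each interface twice, from its two sides, and each boundary face once
  (\<open>sum_cells_faces\<close>). On an interface the two outward normals are opposite, so the two visits
  differ in the sign of the face term.

  Accuracy. Since a stencil Vandermonde matrix has full column rank, its pseudoinverse is a left
  inverse, and so the interpolation from any stencil reproduces the face values of the basis
  polynomials. Applied to the global Vandermonde matrix, a face term therefore no longer depends on
  the cell whose nodes stand in its right factor. Consequently the coupling terms of \<open>S\<close> act on
  polynomials just as the symmetric halves \<open>E\<^sup>c / 2\<close> of the two cells do: the coupling
  with left factor \<open>R\<^sup>-\<close> gives the contribution of the negative cell, and the one with left factor
  \<open>R\<^sup>+\<close>, with its minus sign, that of the positive cell. Boundary faces are accounted for by \<open>E\<close>. Hence \<open>Q V\<close> is the sum of the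
  local \<open>Q\<^sup>c V\<^sup>c = M\<^sup>c V\<^sup>c\<^sub>x\<close>, scattered to the global nodes.

  Boundary term. The face quadratures do not integrate a varying normal exactly, so single faces
  cannot be compared; only the whole boundary of a cell can, by the cell's own SBP property.
  Both sides are therefore summed over all cells. On the discrete side the interfaces cancel and
  \<open>V\<^sup>T E V\<close> remains. On the continuous side the same cancellation has to be shown for surface
  integrals (\<open>sum_cell_boundary_flux\<close>). It needs that faces overlap in null sets, that the
  pointwise normals on an interface are opposite, and that on a boundary face the normal of the cell
  is that of the domain; the latter holds because nested sets with normals at a common point have the
  same normal (\<open>outward_unit_normal_subset\<close>). Splitting the integrals requires integrability, and
  thus Borel measurability of the normal field (\<open>borel_measurable_outward_unit_normal\<close>).
\<close>

section \<open>Full column rank and the pseudoinverse\<close>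

text \<open>
  A matrix with a repeated column has fewer distinct columns than its width, so its rank is smaller.
  Hence the columns are distinct, and full rank makes them linearly independent.
\<close>

lemma full_column_rank_ker_trivial:
  assumes "full_column_rank A" and v: "v \<in> carrier_vec (dim_col A)"
    and Av: "A *\<^sub>v v = 0\<^sub>v (dim_row A)"
  shows "v = 0\<^sub>v (dim_col A)"
proof (rule ccontr)
  assume v0: "v \<noteq> 0\<^sub>v (dim_col A)"
  interpret vec_space "TYPE(real)" "dim_row A" .
  have A: "A \<in> carrier_mat (dim_row A) (dim_col A)" by simp
  have r: "rank A = dim_col A" using assms(1) by (simp add: full_column_rank_def)
  have "distinct (cols A)"
  proof (rule ccontr)
    assume nd: "\<not> distinct (cols A)"
    obtain S where S: "maximal S (\<lambda>T. T \<subseteq> set (cols A) \<and> lin_indpt T)"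
      using maximal_exists[of "(\<lambda>T. T \<subseteq> set (cols A) \<and> lin_indpt T)" "card (set (cols A))" "{}"]
      by (meson List.finite_set card_mono empty_iff empty_subsetI finite_lin_indpt2 rev_finite_subset)
    have "card S \<le> card (set (cols A))" using S by (simp add: card_mono maximal_def)
    also have "\<dots> < dim_col A"
      using nd card_distinct[of "cols A"] card_length[of "cols A"] by (metis cols_length le_neq_implies_less)
    finally show False using rank_card_indpt[OF A S] r by simp
  qed
  then show False
    using lin_depI[OF A v v0 Av] full_rank_lin_indpt[OF A r] by blast
qed

text \<open>
  The Gram matrix has trivial kernel, because \<open>v \<bullet> A\<^sup>T A v\<close> is the squared length of \<open>A v\<close>. The
  symmetry of its inverse \<open>G\<close> is what makes \<open>A G A\<^sup>T\<close> symmetric, as the Penrose conditions demand.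
\<close>

lemma full_column_rank_gram_inverse:
  assumes "full_column_rank A"
  obtains G where "G \<in> carrier_mat (dim_col A) (dim_col A)" "G * (A\<^sup>T * A) = 1\<^sub>m (dim_col A)"
    "G\<^sup>T = G"
proof -
  let ?n = "dim_col A" let ?H = "A\<^sup>T * A"
  have A: "A \<in> carrier_mat (dim_row A) ?n" and AT: "A\<^sup>T \<in> carrier_mat ?n (dim_row A)"
    and H: "?H \<in> carrier_mat ?n ?n" by auto
  have "det ?H \<noteq> 0"
  proof
    assume "det ?H = 0"
    then obtain v where v: "v \<in> carrier_vec ?n" "v \<noteq> 0\<^sub>v ?n" "?H *\<^sub>v v = 0\<^sub>v ?n"
      using det_0_iff_vec_prod_zero_field[OF H] by auto
    have Av: "A *\<^sub>v v \<in> carrier_vec (dim_row A)" by (rule mult_mat_vec_carrier[OF A v(1)])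
    have "scalar_prod (A *\<^sub>v v) (A *\<^sub>v v) = scalar_prod (A\<^sup>T *\<^sub>v (A *\<^sub>v v)) v"
      using transpose_vec_mult_scalar[OF A v(1) Av] by simp
    also have "A\<^sup>T *\<^sub>v (A *\<^sub>v v) = 0\<^sub>v ?n"
      using assoc_mult_mat_vec[OF AT A v(1)] v(3) by simp
    finally have "scalar_prod (A *\<^sub>v v) (A *\<^sub>v v) = 0" using v(1) by simp
    then have "(\<Sum>i<dim_row A. (vec_index (A *\<^sub>v v) i)\<^sup>2) = 0"
      by (simp add: scalar_prod_def power2_eq_square atLeast0LessThan del: index_mult_mat_vec)
    then have "\<forall>i<dim_row A. vec_index (A *\<^sub>v v) i = 0"
      by (subst (asm) sum_nonneg_eq_0_iff) auto
    then have "A *\<^sub>v v = 0\<^sub>v (dim_row A)" by (intro eq_vecI) (auto simp del: index_mult_mat_vec)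
    with full_column_rank_ker_trivial[OF assms v(1)] v(2) show False by simp
  qed
  from det_non_zero_imp_unit[OF H this, of undefined]
  obtain G where G: "G \<in> carrier_mat ?n ?n" "G * ?H = 1\<^sub>m ?n" "?H * G = 1\<^sub>m ?n"
    by (auto simp: Units_def ring_mat_def)
  have HT: "?H\<^sup>T = ?H" using transpose_mult[OF AT A] by simp
  have GTH: "G\<^sup>T * ?H = 1\<^sub>m ?n"
    using transpose_mult[OF H G(1)] G(3) HT by simp
  have "G\<^sup>T = G\<^sup>T * (?H * G)" using G by simp
  also have "\<dots> = (G\<^sup>T * ?H) * G" using assoc_mult_mat[of "G\<^sup>T" ?n ?n ?H ?n G ?n] G(1) H by simp
  also have "\<dots> = G" using GTH G(1) by simp
  finally show ?thesis using that G by blast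
qed

text \<open>
  The projections \<open>A B\<close> and \<open>A C\<close> absorb each other, so by symmetry they coincide, and likewise
  \<open>B A\<close> and \<open>C A\<close>. Then \<open>B = B A B = C A C = C\<close>.
\<close>

lemma is_pseudoinverse_unique:
  assumes B: "is_pseudoinverse A B" and C: "is_pseudoinverse A C"
  shows "B = C"
proof -
  let ?m = "dim_row A" let ?n = "dim_col A"
  have cA: "A \<in> carrier_mat ?m ?n" by simp
  have cB: "B \<in> carrier_mat ?n ?m" and cC: "C \<in> carrier_mat ?n ?m"
    using B C by (auto simp: is_pseudoinverse_def)
  have AB: "A * B \<in> carrier_mat ?m ?m" and AC: "A * C \<in> carrier_mat ?m ?m"
    and BA: "B * A \<in> carrier_mat ?n ?n" and CA: "C * A \<in> carrier_mat ?n ?n"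
    using cB cC by auto
  have e1: "A * B * A = A" "B * A * B = B" "(A * B)\<^sup>T = A * B" "(B * A)\<^sup>T = B * A"
    using B by (auto simp: is_pseudoinverse_def)
  have e2: "A * C * A = A" "C * A * C = C" "(A * C)\<^sup>T = A * C" "(C * A)\<^sup>T = C * A"
    using C by (auto simp: is_pseudoinverse_def)
  have r1: "A * B * (A * C) = A * C"
    using assoc_mult_mat[OF AB cA cC] e1 by simp
  have r2: "A * C * (A * B) = A * B"
    using assoc_mult_mat[OF AC cA cB] e2 by simp
  have "A * B = (A * C * (A * B))\<^sup>T" using r2 e1 by simp
  also have "\<dots> = A * C" using transpose_mult[OF AC AB] r1 e1 e2 by simp
  finally have ab: "A * B = A * C" .
  have l1: "B * A * (C * A) = B * A"
    using assoc_mult_mat[OF cB cA CA] assoc_mult_mat[OF cA cC cA] e2 by simp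
  have l2: "C * A * (B * A) = C * A"
    using assoc_mult_mat[OF cC cA BA] assoc_mult_mat[OF cA cB cA] e1 by simp
  have "B * A = (B * A * (C * A))\<^sup>T" using l1 e1 by simp
  also have "\<dots> = C * A" using transpose_mult[OF BA CA] l2 e1 e2 by simp
  finally have ba: "B * A = C * A" .
  have "B = B * A * B" using e1 by simp
  also have "\<dots> = C * (A * B)" using ba assoc_mult_mat[OF cC cA cB] by simp
  also have "\<dots> = C * A * C" using ab assoc_mult_mat[OF cC cA cC] by simp
  finally show ?thesis using e2 by simp
qed

text \<open>
  The witness is the least-squares inverse \<open>(A\<^sup>T A)\<^sup>-\<^sup>1 A\<^sup>T\<close>; uniqueness identifies it with the
  description operator in the definition.
\<close>

lemma pseudoinverse_left_inverse:
  assumes "full_column_rank A"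
  shows "pseudoinverse A \<in> carrier_mat (dim_col A) (dim_row A)"
    and "pseudoinverse A * A = 1\<^sub>m (dim_col A)"
proof -
  let ?m = "dim_row A" let ?n = "dim_col A"
  obtain G where G: "G \<in> carrier_mat ?n ?n" "G * (A\<^sup>T * A) = 1\<^sub>m ?n" "G\<^sup>T = G"
    using full_column_rank_gram_inverse[OF assms] by blast
  define B where "B = G * A\<^sup>T"
  have A: "A \<in> carrier_mat ?m ?n" and AT: "A\<^sup>T \<in> carrier_mat ?n ?m" by auto
  have B: "B \<in> carrier_mat ?n ?m" unfolding B_def by (rule mult_carrier_mat[OF G(1) AT])
  have BA: "B * A = 1\<^sub>m ?n"
    using assoc_mult_mat[OF G(1) AT A] G(2) by (simp add: B_def)
  have "(A * B)\<^sup>T = A * B"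
    using transpose_mult[OF A B] transpose_mult[OF G(1) AT] G(3) assoc_mult_mat[OF A G(1) AT]
    by (simp add: B_def)
  moreover have "A * B * A = A" using assoc_mult_mat[OF A B A] BA by simp
  ultimately have "is_pseudoinverse A B"
    using B BA by (simp add: is_pseudoinverse_def)
  then have "pseudoinverse A = B"
    unfolding pseudoinverse_def using is_pseudoinverse_unique by blast
  then show "pseudoinverse A \<in> carrier_mat ?n ?m" "pseudoinverse A * A = 1\<^sub>m ?n"
    using B BA by auto
qed


section \<open>Sums and symmetry of matrices\<close>

lemma mat_sum_carrier [simp]: "mat_sum m n A I \<in> carrier_mat m n"
  by (simp add: mat_sum_def)

lemma mat_sum_index [simp]:
  "i < m \<Longrightarrow> j < n \<Longrightarrow> mat_sum m n A I $$ (i, j) = (\<Sum>a\<in>I. A a $$ (i, j))"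
  by (simp add: mat_sum_def)

lemma mat_sum_mult:
  fixes X :: "real mat"
  assumes X: "X \<in> carrier_mat n l" and A: "\<And>a. a \<in> I \<Longrightarrow> A a \<in> carrier_mat m n"
  shows "mat_sum m n A I * X = mat_sum m l (\<lambda>a. A a * X) I"
proof (rule eq_matI)
  fix i j assume "i < dim_row (mat_sum m l (\<lambda>a. A a * X) I)" "j < dim_col (mat_sum m l (\<lambda>a. A a * X) I)"
  then have ij: "i < m" "j < l" by (simp_all add: mat_sum_def)
  have "(mat_sum m n A I * X) $$ (i, j) = (\<Sum>k<n. (\<Sum>a\<in>I. A a $$ (i, k)) * X $$ (k, j))"
    using X ij by (simp add: mat_sum_def scalar_prod_def atLeast0LessThan)
  also have "\<dots> = (\<Sum>a\<in>I. \<Sum>k<n. A a $$ (i, k) * X $$ (k, j))"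
    unfolding sum_distrib_right by (rule sum.swap)
  also have "\<dots> = (\<Sum>a\<in>I. (A a * X) $$ (i, j))"
  proof (rule sum.cong[OF refl])
    fix a assume "a \<in> I"
    from carrier_matD[OF A[OF this]] show "(\<Sum>k<n. A a $$ (i, k) * X $$ (k, j)) = (A a * X) $$ (i, j)"
      using X ij by (simp add: scalar_prod_def atLeast0LessThan)
  qed
  finally show "(mat_sum m n A I * X) $$ (i, j) = mat_sum m l (\<lambda>a. A a * X) I $$ (i, j)"
    using ij by simp
qed (use X in \<open>simp_all add: mat_sum_def\<close>)

lemma transpose_mat_sum:
  assumes "\<And>a. a \<in> I \<Longrightarrow> A a \<in> carrier_mat m n"
  shows "(mat_sum m n A I)\<^sup>T = mat_sum n m (\<lambda>a. (A a)\<^sup>T) I"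
proof (rule eq_matI)
  fix i j assume "i < dim_row (mat_sum n m (\<lambda>a. (A a)\<^sup>T) I)" "j < dim_col (mat_sum n m (\<lambda>a. (A a)\<^sup>T) I)"
  then have ij: "i < n" "j < m" by (simp_all add: mat_sum_def)
  have "A a $$ (j, i) = (A a)\<^sup>T $$ (i, j)" if "a \<in> I" for a
    using carrier_matD[OF assms[OF that]] ij by simp
  then show "(mat_sum m n A I)\<^sup>T $$ (i, j) = mat_sum n m (\<lambda>a. (A a)\<^sup>T) I $$ (i, j)"
    using ij by (simp add: mat_sum_def cong: sum.cong)
qed (simp_all add: mat_sum_def)

lemma mat_sum_cong:
  "(\<And>a. a \<in> I \<Longrightarrow> A a = A' a) \<Longrightarrow> mat_sum m n A I = mat_sum m n A' I"
  unfolding mat_sum_def by (intro arg_cong[of _ _ "Matrix.mat m n"] ext sum.cong) auto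

text \<open>
  Transposition reduces this to multiplication from the right.
\<close>

lemma mult_mat_sum:
  fixes X :: "real mat"
  assumes X: "X \<in> carrier_mat l m" and A: "\<And>a. a \<in> I \<Longrightarrow> A a \<in> carrier_mat m n"
  shows "X * mat_sum m n A I = mat_sum l n (\<lambda>a. X * A a) I"
proof -
  have "(X * mat_sum m n A I)\<^sup>T = (mat_sum m n A I)\<^sup>T * X\<^sup>T"
    by (rule transpose_mult[OF X mat_sum_carrier])
  also have "\<dots> = mat_sum n l (\<lambda>a. (A a)\<^sup>T * X\<^sup>T) I"
    by (simp only: transpose_mat_sum[of I A m n, OF A], rule mat_sum_mult) (use X A in auto)
  also have "\<dots> = mat_sum n l (\<lambda>a. (X * A a)\<^sup>T) I"
    using transpose_mult[OF X A] by (intro mat_sum_cong) simp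
  also have "\<dots> = (mat_sum l n (\<lambda>a. X * A a) I)\<^sup>T"
    by (rule transpose_mat_sum[symmetric]) (use X A in auto)
  finally show ?thesis using transpose_mat_eq by blast
qed

lemma transpose_mat_diag_mult_index:
  fixes X :: "real mat"
  assumes X: "X \<in> carrier_mat m r" and Y: "Y \<in> carrier_mat m s" and ij: "i < r" "j < s"
  shows "(X\<^sup>T * mat_diag m d * Y) $$ (i, j) = (\<Sum>q<m. d q * X $$ (q, i) * Y $$ (q, j))"
proof -
  have "X\<^sup>T * mat_diag m d = Matrix.mat r m (\<lambda>(i, j). X\<^sup>T $$ (i, j) * d j)"
    by (rule mat_diag_mult_right) (use X in simp)
  then have "(X\<^sup>T * mat_diag m d * Y) $$ (i, j) = (\<Sum>q<m. X $$ (q, i) * d q * Y $$ (q, j))"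
    using X Y ij by (simp add: scalar_prod_def atLeast0LessThan)
  then show ?thesis by (simp add: mult.commute[of _ "d _"])
qed

lemma diagonal_mat_eq_mat_diag:
  assumes "diagonal_mat D" "D \<in> carrier_mat m m"
  shows "D = mat_diag m (\<lambda>i. D $$ (i, i))"
  using assms by (intro eq_matI) (auto simp: diagonal_mat_def mat_diag_def)

lemma add_smult_mult_mat:
  fixes A :: "real mat"
  assumes A: "A \<in> carrier_mat m n" and B: "B \<in> carrier_mat m n" and Y: "Y \<in> carrier_mat n l"
  shows "(A + s \<cdot>\<^sub>m B) * Y = A * Y + s \<cdot>\<^sub>m (B * Y)"
  using add_mult_distrib_mat[OF A smult_carrier_mat[OF B, of s] Y] mult_smult_assoc_mat[OF B Y, of s]
  by simp

lemma minus_smult_mult_mat: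
  fixes A :: "real mat"
  assumes A: "A \<in> carrier_mat m n" and B: "B \<in> carrier_mat m n" and Y: "Y \<in> carrier_mat n l"
  shows "(A - s \<cdot>\<^sub>m B) * Y = A * Y - s \<cdot>\<^sub>m (B * Y)"
  using minus_mult_distrib_mat[OF A smult_carrier_mat[OF B, of s] Y] mult_smult_assoc_mat[OF B Y, of s]
  by simp

lemma mult_add_smult_mat:
  fixes A :: "real mat"
  assumes X: "X \<in> carrier_mat k m" and A: "A \<in> carrier_mat m n" and B: "B \<in> carrier_mat m n"
  shows "X * (A + s \<cdot>\<^sub>m B) = X * A + s \<cdot>\<^sub>m (X * B)"
  using mult_add_distrib_mat[OF X A smult_carrier_mat[OF B, of s]] mult_smult_distrib[OF X B, of s]
  by simp

lemma congruence_assoc: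
  fixes X :: "real mat"
  assumes X: "X \<in> carrier_mat m n" and D: "D \<in> carrier_mat m m"
  shows "X\<^sup>T * D * X = X\<^sup>T * (D * X)"
  by (rule assoc_mult_mat[OF _ D X, of _ n]) (use X in simp)

lemma congruence_mult_assoc:
  fixes X :: "real mat"
  assumes X: "X \<in> carrier_mat m n" and D: "D \<in> carrier_mat m m" and Y: "Y \<in> carrier_mat n l"
  shows "X\<^sup>T * D * X * Y = X\<^sup>T * (D * (X * Y))"
proof -
  have XT: "X\<^sup>T \<in> carrier_mat n m" using X by simp
  show ?thesis
    using assoc_mult_mat[OF mult_carrier_mat[OF XT D] X Y]
      assoc_mult_mat[OF XT D mult_carrier_mat[OF X Y]] by simp
qed

lemma skew_symmetric_mat_iff:
  assumes "A \<in> carrier_mat m m"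
  shows "skew_symmetric_mat A \<longleftrightarrow> (\<forall>i<m. \<forall>j<m. A $$ (j, i) = - A $$ (i, j))"
proof
  assume "skew_symmetric_mat A"
  then have eq: "A\<^sup>T = - A" by (simp add: skew_symmetric_mat_def)
  show "\<forall>i<m. \<forall>j<m. A $$ (j, i) = - A $$ (i, j)"
  proof (intro allI impI)
    fix i j assume "i < m" "j < m"
    then show "A $$ (j, i) = - A $$ (i, j)"
      using arg_cong[OF eq, of "\<lambda>X. X $$ (i, j)"] carrier_matD[OF assms] by simp
  qed
next
  assume R: "\<forall>i<m. \<forall>j<m. A $$ (j, i) = - A $$ (i, j)"
  show "skew_symmetric_mat A" unfolding skew_symmetric_mat_def
  proof (rule eq_matI)
    fix i j assume "i < dim_row (- A)" "j < dim_col (- A)"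
    then have ij: "i < m" "j < m" using carrier_matD[OF assms] by simp_all
    then have "A $$ (j, i) = - A $$ (i, j)" using R by blast
    then show "A\<^sup>T $$ (i, j) = (- A) $$ (i, j)" using ij carrier_matD[OF assms] by simp
  qed (use carrier_matD[OF assms] in simp_all)
qed

lemma symmetric_mat_index:
  assumes "symmetric_mat A" "A \<in> carrier_mat m m" "i < m" "j < m"
  shows "A $$ (j, i) = A $$ (i, j)"
proof -
  have "A\<^sup>T $$ (i, j) = A $$ (i, j)" using assms(1) by (simp add: symmetric_mat_def)
  then show ?thesis using assms(2-4) by simp
qed

lemma skew_symmetric_mat_congruence:
  assumes "skew_symmetric_mat A" and A: "A \<in> carrier_mat m m" and X: "X \<in> carrier_mat m n"
  shows "skew_symmetric_mat (X\<^sup>T * A * X)"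
proof -
  have XT: "X\<^sup>T \<in> carrier_mat n m" using X by simp
  have "(X\<^sup>T * A * X)\<^sup>T = X\<^sup>T * (A\<^sup>T * X)"
    using transpose_mult[OF mult_carrier_mat[OF XT A] X] transpose_mult[OF XT A] by simp
  also have "A\<^sup>T = - A" using assms(1) by (simp add: skew_symmetric_mat_def)
  also have "X\<^sup>T * (- A * X) = - (X\<^sup>T * (A * X))"
    using A X by (simp add: uminus_mult_left_mat uminus_mult_right_mat)
  also have "X\<^sup>T * (A * X) = X\<^sup>T * A * X" by (rule assoc_mult_mat[OF XT A X, symmetric])
  finally show ?thesis by (simp add: skew_symmetric_mat_def)
qed

lemma skew_symmetric_mat_sum:
  assumes "\<And>a. a \<in> I \<Longrightarrow> A a \<in> carrier_mat m m" "\<And>a. a \<in> I \<Longrightarrow> skew_symmetric_mat (A a)"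
  shows "skew_symmetric_mat (mat_sum m m A I)"
proof -
  have "mat_sum m m A I $$ (j, i) = - mat_sum m m A I $$ (i, j)" if ij: "i < m" "j < m" for i j
  proof -
    have "A a $$ (j, i) = - A a $$ (i, j)" if "a \<in> I" for a
      using skew_symmetric_mat_iff[OF assms(1)[OF that]] assms(2)[OF that] ij by blast
    then have "(\<Sum>a\<in>I. A a $$ (j, i)) = (\<Sum>a\<in>I. - A a $$ (i, j))" by (rule sum.cong[OF refl])
    then show ?thesis using ij by (simp add: sum_negf)
  qed
  then show ?thesis using skew_symmetric_mat_iff[OF mat_sum_carrier] by blast
qed

text \<open>
  Identifies the boundary matrix that the SBP property of a cell merely asserts to exist with the one
  that is given explicitly: \<open>E = Q + Q\<^sup>T\<close> in both cases.
\<close>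

lemma symmetric_part_unique:
  assumes S: "S \<in> carrier_mat m m" "S' \<in> carrier_mat m m"
    and E: "E \<in> carrier_mat m m" "E' \<in> carrier_mat m m"
    and skew: "skew_symmetric_mat S" "skew_symmetric_mat S'"
    and sym: "symmetric_mat E" "symmetric_mat E'"
    and eq: "S + (1 / 2) \<cdot>\<^sub>m E = S' + (1 / 2) \<cdot>\<^sub>m E'"
  shows "E = E'"
proof (rule eq_matI)
  fix i j assume "i < dim_row E'" "j < dim_col E'"
  then have ij: "i < m" "j < m" using E by auto
  have e: "S $$ (a, b) + E $$ (a, b) / 2 = S' $$ (a, b) + E' $$ (a, b) / 2" if "a < m" "b < m" for a b
    using arg_cong[OF eq, of "\<lambda>A. A $$ (a, b)"] S E that by simp
  have "S $$ (j, i) = - S $$ (i, j)" "S' $$ (j, i) = - S' $$ (i, j)"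
    using skew ij skew_symmetric_mat_iff[OF S(1)] skew_symmetric_mat_iff[OF S(2)] by blast+
  moreover note symmetric_mat_index[OF sym(1) E(1) ij] symmetric_mat_index[OF sym(2) E(2) ij]
  ultimately show "E $$ (i, j) = E' $$ (i, j)"
    using e[OF ij] e[OF ij(2,1)] by simp
qed (use E in auto)

text \<open>
  The shape of the global \<open>S\<close>: the two families of interface couplings are transposes of each other.
\<close>

lemma skew_symmetric_mat_add_antisymmetrised:
  assumes A: "A \<in> carrier_mat m m" "skew_symmetric_mat A" and B: "B \<in> carrier_mat m m"
  shows "skew_symmetric_mat (A + s \<cdot>\<^sub>m B - s \<cdot>\<^sub>m B\<^sup>T)"
proof -
  have C: "A + s \<cdot>\<^sub>m B - s \<cdot>\<^sub>m B\<^sup>T \<in> carrier_mat m m"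
    using B by (intro minus_carrier_mat) simp
  let ?Z = "A + s \<cdot>\<^sub>m B - s \<cdot>\<^sub>m B\<^sup>T"
  have Z: "?Z $$ (i, j) = A $$ (i, j) + s * B $$ (i, j) - s * B $$ (j, i)" if "i < m" "j < m" for i j
    using that carrier_matD[OF A(1)] carrier_matD[OF B] by simp
  have "?Z $$ (j, i) = - ?Z $$ (i, j)" if ij: "i < m" "j < m" for i j
  proof -
    have "A $$ (j, i) = - A $$ (i, j)" using skew_symmetric_mat_iff[OF A(1)] A(2) ij by blast
    then show ?thesis unfolding Z[OF ij] Z[OF ij(2,1)] by simp
  qed
  then show ?thesis using skew_symmetric_mat_iff[OF C] by blast
qed


section \<open>Outward unit normals\<close>

text \<open>
  The condition on a unit normal at a fixed tolerance \<open>\<epsilon>\<close> and radius \<open>\<delta>\<close>. Separating the two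
  parameters exhibits the normal condition as a countable combination of closed conditions.
\<close>

definition half_space_like ::
  "(real ^ 'd::finite) set \<Rightarrow> real ^ 'd \<Rightarrow> real ^ 'd \<Rightarrow> real \<Rightarrow> real \<Rightarrow> bool" where
  "half_space_like A x \<nu> \<epsilon> \<delta> \<longleftrightarrow>
     (\<forall>y. dist y x < \<delta> \<longrightarrow>
        ((y - x) \<bullet> \<nu> < - \<epsilon> * norm (y - x) \<longrightarrow> y \<in> A) \<and>
        ((y - x) \<bullet> \<nu> > \<epsilon> * norm (y - x) \<longrightarrow> y \<notin> A))"

lemma is_outward_unit_normal_alt:
  "is_outward_unit_normal A x \<nu> \<longleftrightarrow>
     norm \<nu> = 1 \<and> (\<forall>\<epsilon>>0. \<exists>\<delta>>0. half_space_like A x \<nu> \<epsilon> \<delta>)"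
  by (simp add: is_outward_unit_normal_def half_space_like_def)

text \<open>
  If the two directions were far apart, a point slightly displaced from \<open>x\<close> along \<open>\<mu> - \<nu>\<close> would lie
  well behind the plane of \<open>\<nu>\<close>, hence in \<open>A\<close>, and well in front of that of \<open>\<mu>\<close>, hence outside \<open>A'\<close>.
  The case \<open>A = A'\<close> gives uniqueness of normals and convergence of approximate ones; the case of a
  cell inside the domain compares their normals.
\<close>

lemma half_space_like_normals_close:
  fixes \<nu> \<mu> :: "real ^ 'd::finite"
  assumes A: "half_space_like A x \<nu> \<epsilon>1 \<delta>1" "\<delta>1 > 0" "norm \<nu> = 1"
    and A': "half_space_like A' x \<mu> \<epsilon>2 \<delta>2" "\<delta>2 > 0" "norm \<mu> = 1"
    and "A \<subseteq> A'" and "\<epsilon>1 \<ge> 0"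
  shows "norm (\<mu> - \<nu>) \<le> 2 * max \<epsilon>1 \<epsilon>2"
proof (rule ccontr)
  assume far: "\<not> norm (\<mu> - \<nu>) \<le> 2 * max \<epsilon>1 \<epsilon>2"
  define L where "L = norm (\<mu> - \<nu>)"
  have L: "L > 2 * \<epsilon>1" "L > 2 * \<epsilon>2" using far by (auto simp: L_def)
  have LL: "L\<^sup>2 = 2 - 2 * (\<mu> \<bullet> \<nu>)"
    using A(3) A'(3) by (simp add: L_def power2_norm_eq_inner inner_diff inner_commute norm_eq_1)
  have "L > 0" using L(1) \<open>\<epsilon>1 \<ge> 0\<close> by simp
  \<comment> \<open>the displacement has length \<open>t * L\<close>, which is half the smaller radius\<close>
  define t where "t = min \<delta>1 \<delta>2 / (2 * L)"
  have t: "t > 0" "t * L < \<delta>1" "t * L < \<delta>2"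
    using A(2) A'(2) \<open>L > 0\<close> by (auto simp: t_def field_simps min_def)
  define y where "y = x + t *\<^sub>R (\<mu> - \<nu>)"
  have n: "norm (y - x) = t * L" using t by (simp add: y_def L_def)
  have d: "dist y x < \<delta>1" "dist y x < \<delta>2" using n t by (auto simp: dist_norm)
  \<comment> \<open>both vectors are unit vectors, so \<open>\<mu> - \<nu>\<close> makes the same angle with \<open>\<mu>\<close> as with \<open>- \<nu>\<close>\<close>
  have "(\<mu> - \<nu>) \<bullet> \<nu> = - L\<^sup>2 / 2" "(\<mu> - \<nu>) \<bullet> \<mu> = L\<^sup>2 / 2"
    using LL A(3) A'(3) by (auto simp: inner_diff inner_commute norm_eq_1)
  then have i: "(y - x) \<bullet> \<nu> = - (t * L) * (L / 2)" "(y - x) \<bullet> \<mu> = (t * L) * (L / 2)"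
    by (simp_all add: y_def power2_eq_square)
  have p: "t * L > 0" using t \<open>L > 0\<close> by simp
  have "(t * L) * \<epsilon>1 < (t * L) * (L / 2)" "(t * L) * \<epsilon>2 < (t * L) * (L / 2)"
    by (rule mult_strict_left_mono[OF _ p], use L in simp)+
  then have "(y - x) \<bullet> \<nu> < - \<epsilon>1 * norm (y - x)" "(y - x) \<bullet> \<mu> > \<epsilon>2 * norm (y - x)"
    unfolding i n by (simp_all only: mult_minus_left neg_less_iff_less mult.commute[of _ "t * L"])
  then have "y \<in> A" "y \<notin> A'"
    using A(1) A'(1) d unfolding half_space_like_def by blast+
  with \<open>A \<subseteq> A'\<close> show False by blast
qed

lemma outward_unit_normal_subset:
  assumes "is_outward_unit_normal A x \<nu>" "is_outward_unit_normal A' x \<mu>" "A \<subseteq> A'"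
  shows "\<mu> = \<nu>"
proof -
  have "norm (\<mu> - \<nu>) \<le> 0 + e" if "e > 0" for e
  proof -
    have n: "norm \<nu> = 1" "norm \<mu> = 1" and e: "e / 2 > 0"
      using assms that by (simp_all add: is_outward_unit_normal_def)
    obtain \<delta>1 where d1: "half_space_like A x \<nu> (e / 2) \<delta>1" "\<delta>1 > 0"
      using assms(1) e unfolding is_outward_unit_normal_alt by blast
    obtain \<delta>2 where d2: "half_space_like A' x \<mu> (e / 2) \<delta>2" "\<delta>2 > 0"
      using assms(2) e unfolding is_outward_unit_normal_alt by blast
    from half_space_like_normals_close[OF d1 n(1) d2 n(2) assms(3)] e show ?thesis by simp
  qed
  from field_le_epsilon[OF this] show ?thesis by simp
qed

lemma outward_unit_normal_eq:
  assumes "is_outward_unit_normal A x \<nu>"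
  shows "outward_unit_normal A x = \<nu>"
proof -
  have "(THE \<nu>. is_outward_unit_normal A x \<nu>) = \<nu>"
    using outward_unit_normal_subset[OF assms _ order_refl] by (intro the_equality assms)
  with assms show ?thesis by (auto simp: outward_unit_normal_def)
qed

lemma norm_outward_unit_normal_le: "norm (outward_unit_normal A x) \<le> 1"
proof (cases "\<exists>\<nu>. is_outward_unit_normal A x \<nu>")
  case True
  then obtain \<nu> where "is_outward_unit_normal A x \<nu>" by blast
  with outward_unit_normal_eq[OF this] show ?thesis by (simp add: is_outward_unit_normal_def)
qed (simp add: outward_unit_normal_def)

text \<open>
  Tilting the direction costs as much tolerance as the distance between the two directions.
\<close>

lemma half_space_like_perturb:
  assumes "half_space_like A x \<nu> \<epsilon> \<delta>" "\<epsilon> + norm (\<mu> - \<nu>) \<le> \<epsilon>'" "\<delta>' \<le> \<delta>"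
  shows "half_space_like A x \<mu> \<epsilon>' \<delta>'"
proof -
  have key: "\<bar>(y - x) \<bullet> \<mu> - (y - x) \<bullet> \<nu>\<bar> \<le> (\<epsilon>' - \<epsilon>) * norm (y - x)" for y
  proof -
    have "\<bar>(y - x) \<bullet> \<mu> - (y - x) \<bullet> \<nu>\<bar> \<le> norm (y - x) * norm (\<mu> - \<nu>)"
      using Cauchy_Schwarz_ineq2[of "y - x" "\<mu> - \<nu>"] by (simp add: inner_diff_right)
    also have "\<dots> \<le> norm (y - x) * (\<epsilon>' - \<epsilon>)" using assms(2) by (intro mult_left_mono) auto
    finally show ?thesis by (simp add: mult.commute)
  qed
  show ?thesis unfolding half_space_like_def
  proof (intro allI impI conjI)
    fix y assume y: "dist y x < \<delta>'"
    then have y': "dist y x < \<delta>" using assms(3) by simp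
    show "y \<in> A" if "(y - x) \<bullet> \<mu> < - \<epsilon>' * norm (y - x)"
    proof -
      have "(y - x) \<bullet> \<nu> < - \<epsilon> * norm (y - x)" using key[of y] that by (simp add: algebra_simps)
      then show ?thesis using assms(1) y' by (auto simp: half_space_like_def)
    qed
    show "y \<notin> A" if "(y - x) \<bullet> \<mu> > \<epsilon>' * norm (y - x)"
    proof -
      have "(y - x) \<bullet> \<nu> > \<epsilon> * norm (y - x)" using key[of y] that by (simp add: algebra_simps)
      then show ?thesis using assms(1) y' by (auto simp: half_space_like_def)
    qed
  qed
qed

text \<open>
  For a fixed point \<open>y\<close> the condition excludes a set of pairs that is open, because its defining
  inequalities are strict.
\<close>

lemma closed_half_space_like: "closed {(\<nu>, x). half_space_like A x \<nu> \<epsilon> \<delta>}"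
proof -
  have "{(\<nu>, x). half_space_like A x \<nu> \<epsilon> \<delta>} =
      (\<Inter>y\<in>A. {(\<nu>, x). dist y x \<ge> \<delta> \<or> (y - x) \<bullet> \<nu> \<le> \<epsilon> * norm (y - x)}) \<inter>
      (\<Inter>y\<in>-A. {(\<nu>, x). dist y x \<ge> \<delta> \<or> (y - x) \<bullet> \<nu> \<ge> - \<epsilon> * norm (y - x)})"
    unfolding half_space_like_def by (fastforce simp: not_less[symmetric])
  also have "closed \<dots>"
    unfolding case_prod_unfold
    by (intro closed_Int closed_INT ballI closed_Collect_disj closed_Collect_le continuous_intros)
  finally show ?thesis .
qed

text \<open>
  Interchanges the quantifiers over directions and tolerances: it suffices that a direction exists for
  each tolerance separately. Such directions form a Cauchy sequence as the tolerance shrinks, because two of them differ by at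
  most twice the larger tolerance, and their limit is a normal, since tilting towards it costs arbitrarily little. The
  right-hand side is a countable combination of sets that are closed in \<open>x\<close>.
\<close>

lemma ex_outward_unit_normal_in_closed_iff:
  fixes A :: "(real ^ 'd::finite) set"
  assumes "closed K"
  shows "(\<exists>\<nu>\<in>K. is_outward_unit_normal A x \<nu>) \<longleftrightarrow>
    (\<forall>m. \<exists>n. \<exists>\<nu>\<in>K \<inter> sphere 0 1. half_space_like A x \<nu> (1 / real (Suc m)) (1 / real (Suc n)))"
    (is "?L \<longleftrightarrow> ?R")
proof
  assume ?L
  then obtain \<nu> where \<nu>: "\<nu> \<in> K" "norm \<nu> = 1"
    "\<And>\<epsilon>. \<epsilon> > 0 \<Longrightarrow> \<exists>\<delta>>0. half_space_like A x \<nu> \<epsilon> \<delta>"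
    unfolding is_outward_unit_normal_alt by blast
  show ?R
  proof
    fix m
    obtain \<delta> where \<delta>: "\<delta> > 0" "half_space_like A x \<nu> (1 / real (Suc m)) \<delta>"
      using \<nu>(3)[of "1 / real (Suc m)"] by auto
    obtain n where "1 / real (Suc n) < \<delta>" using \<delta>(1) nat_approx_posE by blast
    then have "half_space_like A x \<nu> (1 / real (Suc m)) (1 / real (Suc n))"
      using \<delta>(2) by (intro half_space_like_perturb[OF \<delta>(2)]) auto
    moreover have "\<nu> \<in> K \<inter> sphere 0 1" using \<nu> by simp
    ultimately show "\<exists>n. \<exists>\<nu>\<in>K \<inter> sphere 0 1. half_space_like A x \<nu> (1 / real (Suc m)) (1 / real (Suc n))"
      by blast
  qed
next
  assume ?R
  then obtain n \<nu> where \<nu>: "\<And>m. \<nu> m \<in> K" "\<And>m. norm (\<nu> m) = 1"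
    and h: "\<And>m. half_space_like A x (\<nu> m) (1 / real (Suc m)) (1 / real (Suc (n m)))"
    by (simp add: Bex_def) metis
  have close: "norm (\<nu> j - \<nu> i) \<le> 2 * (1 / real (Suc i))" if "i \<le> j" for i j
  proof -
    have "1 / real (Suc j) \<le> 1 / real (Suc i)" using that by (simp add: frac_le)
    then show ?thesis
      using half_space_like_normals_close[OF h[of i] _ \<nu>(2) h[of j] _ \<nu>(2)] by simp
  qed
  have "Cauchy \<nu>"
  proof (rule metric_CauchyI)
    fix e :: real assume "e > 0"
    then obtain M where M: "1 / real (Suc M) < e / 4" using nat_approx_posE[of "e / 4"] by auto
    have "dist (\<nu> i) (\<nu> j) < e" if "i \<ge> M" "j \<ge> M" for i j
    proof -
      have "dist (\<nu> i) (\<nu> j) \<le> dist (\<nu> i) (\<nu> M) + dist (\<nu> j) (\<nu> M)"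
        by (rule dist_triangle2)
      also have "\<dots> \<le> 2 * (1 / real (Suc M)) + 2 * (1 / real (Suc M))"
        using close[OF that(1)] close[OF that(2)] by (intro add_mono) (simp_all add: dist_norm)
      also have "\<dots> < e" using M by simp
      finally show ?thesis .
    qed
    then show "\<exists>M. \<forall>m\<ge>M. \<forall>n\<ge>M. dist (\<nu> m) (\<nu> n) < e" by blast
  qed
  then obtain \<mu> where lim: "\<nu> \<longlonglongrightarrow> \<mu>" using Cauchy_convergent convergent_def by blast
  have "\<mu> \<in> K" using closed_sequentially[OF assms] \<nu>(1) lim by blast
  moreover have "norm \<mu> = 1"
    using tendsto_norm[OF lim] \<nu>(2) by (simp add: LIMSEQ_const_iff)
  moreover have "\<exists>\<delta>>0. half_space_like A x \<mu> \<epsilon> \<delta>" if "\<epsilon> > 0" for \<epsilon>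
  proof -
    have pos: "\<epsilon> / 2 > 0" using that by simp
    obtain M where M: "1 / real (Suc M) < \<epsilon> / 2" using nat_approx_posE[OF pos] by blast
    obtain M' where M': "\<And>i. i \<ge> M' \<Longrightarrow> dist (\<nu> i) \<mu> < \<epsilon> / 2"
      using metric_LIMSEQ_D[OF lim pos] by blast
    define i where "i = max M M'"
    have "1 / real (Suc i) \<le> 1 / real (Suc M)" by (simp add: i_def frac_le)
    moreover have "norm (\<mu> - \<nu> i) < \<epsilon> / 2"
      using M'[of i] by (simp add: i_def dist_norm norm_minus_commute)
    ultimately have "half_space_like A x \<mu> \<epsilon> (1 / real (Suc (n i)))"
      using M by (intro half_space_like_perturb[OF h[of i]]) auto
    then show ?thesis by (intro exI[of _ "1 / real (Suc (n i))"]) auto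
  qed
  ultimately show ?L unfolding is_outward_unit_normal_alt by blast
qed

text \<open>
  The unit sphere is compact, so projecting a closed set of pairs along it yields a closed set.
\<close>

lemma sets_ex_outward_unit_normal_in_closed:
  fixes A :: "(real ^ 'd::finite) set"
  assumes "closed K"
  shows "{x. \<exists>\<nu>\<in>K. is_outward_unit_normal A x \<nu>} \<in> sets borel"
proof -
  have cl: "closed {x. \<exists>\<nu>\<in>K \<inter> sphere 0 1. half_space_like A x \<nu> \<epsilon> \<delta>}" for \<epsilon> \<delta>
    using closed_compact_projection[OF closed_Int_compact[OF assms compact_sphere[of 0 1]]
      closed_half_space_like[of A \<epsilon> \<delta>]]
    unfolding Bex_def mem_Collect_eq prod.case .
  have "{x. \<exists>\<nu>\<in>K. is_outward_unit_normal A x \<nu>} = (\<Inter>m. \<Union>n. {x. \<exists>\<nu>\<in>K \<inter> sphere 0 1.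
      half_space_like A x \<nu> (1 / real (Suc m)) (1 / real (Suc n))})"
    unfolding ex_outward_unit_normal_in_closed_iff[OF assms] by auto
  also have "\<dots> \<in> sets borel"
    using borel_closed[OF cl] by (intro sets.countable_INT'' sets.countable_UN' image_subsetI) auto
  finally show ?thesis .
qed

text \<open>
  Preimages of closed sets are Borel up to the points without a normal, where the value is \<open>0\<close>;
  these points form a Borel set too.
\<close>

lemma borel_measurable_outward_unit_normal [measurable]:
  fixes A :: "(real ^ 'd::finite) set"
  shows "outward_unit_normal A \<in> borel_measurable borel"
proof (rule borel_measurableI)
  fix S :: "(real ^ 'd) set" assume "open S"
  let ?D = "\<lambda>K. {x. \<exists>\<nu>\<in>K. is_outward_unit_normal A x \<nu>}"
  have "outward_unit_normal A -` (- S) = ?D (- S) \<union> (if 0 \<in> S then {} else - ?D UNIV)"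
  proof (rule Set.set_eqI)
    fix x
    show "x \<in> outward_unit_normal A -` (- S) \<longleftrightarrow> x \<in> ?D (- S) \<union> (if 0 \<in> S then {} else - ?D UNIV)"
    proof (cases "\<exists>\<nu>. is_outward_unit_normal A x \<nu>")
      case True
      then show ?thesis using outward_unit_normal_eq[of A x] by auto
    next
      case False
      then have "outward_unit_normal A x = 0" by (simp add: outward_unit_normal_def)
      with False show ?thesis by auto
    qed
  qed
  also have "\<dots> \<in> sets borel"
    using sets_ex_outward_unit_normal_in_closed[of "- S" A]
      sets_ex_outward_unit_normal_in_closed[of UNIV A] \<open>open S\<close>
    by (auto intro!: sets.Un borel_comp)
  finally show "outward_unit_normal A -` S \<inter> space borel \<in> sets borel"
    by (metis borel_comp double_complement inf_top_right space_borel vimage_Compl)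
qed

text \<open>
  A point that has a normal is itself seen by the filter, so the limit must be the value there.
\<close>

lemma face_normal_eq_outward_unit_normal:
  assumes "has_face_normal A S x" "x \<in> S" "is_outward_unit_normal A x \<nu>"
  shows "face_normal A S x = \<nu>"
proof -
  let ?F = "face_normal_filter A S x"
  obtain \<mu> where F: "?F \<noteq> bot" and lim: "(outward_unit_normal A \<longlongrightarrow> \<mu>) ?F"
    using assms(1) by (auto simp: has_face_normal_def)
  have le: "principal {x} \<le> ?F"
    using assms(2,3) unfolding face_normal_filter_def le_filter_def
    by (auto simp: eventually_principal eventually_inf_principal dest: eventually_nhds_x_imp_x)
  have "(outward_unit_normal A \<longlongrightarrow> \<mu>) (principal {x})" using tendsto_mono[OF le lim] .
  moreover have "(outward_unit_normal A \<longlongrightarrow> \<nu>) (principal {x})"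
    using outward_unit_normal_eq[OF assms(3)]
    by (auto simp: tendsto_def eventually_principal)
  ultimately have "\<mu> = \<nu>"
    by (intro tendsto_unique[of "principal {x}"]) (auto simp: principal_eq_bot_iff)
  with tendsto_Lim[OF F lim] show ?thesis by (simp add: face_normal_def)
qed

section \<open>Integrals over boundaries\<close>

lemma space_surface_measure [simp]: "space surface_measure = UNIV"
  by (simp add: surface_measure_def space_measure_of_conv)

lemma sets_surface_measure [simp, measurable_cong]: "sets surface_measure = sets borel"
  using sets.sigma_sets_eq[of borel] by (simp add: surface_measure_def sets_measure_of_conv)

lemma continuous_on_poly_space: "q \<in> poly_space p \<Longrightarrow> continuous_on UNIV q"
proof -
  assume "q \<in> poly_space p"
  then obtain c where "\<And>x. q x =
      (\<Sum>\<alpha> | (\<Sum>i\<in>UNIV. \<alpha> i) \<le> p. c \<alpha> * (\<Prod>i\<in>UNIV. x $ i ^ \<alpha> i))"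
    by (auto simp: poly_space_def)
  then have "q = (\<lambda>x. \<Sum>\<alpha> | (\<Sum>i\<in>UNIV. \<alpha> i) \<le> p. c \<alpha> * (\<Prod>i\<in>UNIV. x $ i ^ \<alpha> i))"
    by blast
  then show ?thesis by (simp add: continuous_intros)
qed

lemma borel_measurable_outward_unit_normal_component [measurable]:
  "(\<lambda>x. outward_unit_normal A x $ k) \<in> borel_measurable borel"
proof -
  have "(\<lambda>v. v $ k) \<in> borel_measurable borel"
    by (intro borel_measurable_continuous_onI continuous_intros)
  from measurable_compose[OF borel_measurable_outward_unit_normal this] show ?thesis .
qed

text \<open>
  The integrand is bounded on the compact boundary, which has finite area.
\<close>

lemma set_integrable_boundary_flux:
  fixes A :: "(real ^ 'd::finite) set"
  assumes g: "continuous_on UNIV g" and A: "bounded A"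
    and fin: "emeasure surface_measure (frontier A) < \<infinity>"
  shows "set_integrable surface_measure (frontier A) (\<lambda>y. g y * outward_unit_normal A y $ k)"
proof -
  have [measurable]: "g \<in> borel_measurable borel"
    using g by (rule borel_measurable_continuous_onI)
  have cpt: "compact (g ` frontier A)"
    by (intro compact_continuous_image continuous_on_subset[OF g] compact_frontier_bounded A) simp
  then obtain B where B: "\<And>y. y \<in> frontier A \<Longrightarrow> norm (g y) \<le> B"
    using compact_imp_bounded[OF cpt] unfolding bounded_iff by auto
  have "norm (g y * outward_unit_normal A y $ k) \<le> B" if "y \<in> frontier A" for y
  proof -
    have "\<bar>outward_unit_normal A y $ k\<bar> \<le> 1"
      using component_le_norm_cart[of "outward_unit_normal A y" k] norm_outward_unit_normal_le[of A y]
      by linarith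
    then have "\<bar>g y\<bar> * \<bar>outward_unit_normal A y $ k\<bar> \<le> \<bar>g y\<bar> * 1" by (intro mult_left_mono) auto
    then show ?thesis using B[OF that] by (simp add: abs_mult)
  qed
  moreover have "frontier A \<in> sets surface_measure"
    "(\<lambda>y. g y * outward_unit_normal A y $ k) \<in> borel_measurable surface_measure"
    by (simp_all add: borel_closed) measurable
  ultimately show ?thesis
    unfolding set_integrable_def
    using fin by (intro integrableI_bounded_set_indicator[where B=B] AE_I2) simp_all
qed

lemma set_integral_almost_disjoint_UN:
  fixes f :: "'a \<Rightarrow> real"
  assumes "finite I" and "\<And>i. i \<in> I \<Longrightarrow> S i \<in> sets M"
    and "\<And>i j. i \<in> I \<Longrightarrow> j \<in> I \<Longrightarrow> i \<noteq> j \<Longrightarrow> emeasure M (S i \<inter> S j) = 0"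
    and "set_integrable M (\<Union>i\<in>I. S i) f"
  shows "(LINT x:(\<Union>i\<in>I. S i)|M. f x) = (\<Sum>i\<in>I. LINT x:S i|M. f x)"
  using assms
proof (induction I rule: finite_induct)
  case empty
  then show ?case by (simp add: set_lebesgue_integral_def)
next
  case (insert i I)
  have UI: "(\<Union>j\<in>I. S j) \<in> sets M" using insert by (intro sets.finite_UN) auto
  have int: "set_integrable M (S i) f" "set_integrable M (\<Union>j\<in>I. S j) f"
    using insert.prems(1) UI by (auto intro: set_integrable_subset[OF insert.prems(3)])
  have "AE x in M. \<not> (x \<in> S i \<and> x \<in> S j)" if "j \<in> I" for j
    using insert that by (intro AE_I[of _ _ "S i \<inter> S j"]) auto
  then have "AE x in M. \<forall>j\<in>I. \<not> (x \<in> S i \<and> x \<in> S j)"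
    using insert.hyps(1) by (intro AE_finite_allI)
  then have ae: "AE x in M. \<not> (x \<in> S i \<and> x \<in> (\<Union>j\<in>I. S j))" by eventually_elim auto
  have "(LINT x:(\<Union>j\<in>insert i I. S j)|M. f x) = (LINT x:S i \<union> (\<Union>j\<in>I. S j)|M. f x)" by simp
  also have "\<dots> = (LINT x:S i|M. f x) + (LINT x:(\<Union>j\<in>I. S j)|M. f x)"
    using insert.prems(1) UI int by (intro set_integral_Un_AE[OF ae]) auto
  also have "(LINT x:(\<Union>j\<in>I. S j)|M. f x) = (\<Sum>j\<in>I. LINT x:S j|M. f x)"
    using insert.prems int by (intro insert.IH) auto
  finally show ?case using insert.hyps by simp
qed


section \<open>Cancellation across interfaces\<close>

lemma interface_adjacent_cells:
  assumes "axis_aligned_interfaces T" "f \<in> interfaces T"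
  shows "{c. c < n_cells T \<and> f \<in> cell_faces T c} = {neg_cell T f, pos_cell T f}"
    and "neg_cell T f \<noteq> pos_cell T f"
  using assms by (simp_all add: axis_aligned_interfaces_def)

lemma bdry_face_adjacent_cells:
  assumes "mesh_faces T" "f \<in> bdry_faces T"
  shows "{c. c < n_cells T \<and> f \<in> cell_faces T c} = {bdry_cell T f}"
  using assms by (simp add: mesh_faces_def)

text \<open>
  Double counting: an interface is met from its two adjacent cells, a boundary face from one.
\<close>

lemma sum_cells_faces:
  fixes h :: "nat \<Rightarrow> nat \<Rightarrow> real"
  assumes "mesh_faces T" "axis_aligned_interfaces T"
  shows "(\<Sum>c<n_cells T. \<Sum>f\<in>cell_faces T c. h c f) =
    (\<Sum>f\<in>interfaces T. h (neg_cell T f) f + h (pos_cell T f) f) +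
    (\<Sum>f\<in>bdry_faces T. h (bdry_cell T f) f)"
proof -
  let ?adj = "\<lambda>f. {c. c < n_cells T \<and> f \<in> cell_faces T c}"
  have sub: "cell_faces T c \<subseteq> {..<n_faces T}" if "c < n_cells T" for c
    using assms(1) that by (simp add: mesh_faces_def)
  have un: "{..<n_faces T} = interfaces T \<union> bdry_faces T" and dis: "interfaces T \<inter> bdry_faces T = {}"
    using assms(1) by (simp_all add: mesh_faces_def)
  have fin: "finite (interfaces T)" "finite (bdry_faces T)"
    using finite_lessThan[of "n_faces T"] unfolding un by auto
  have "(\<Sum>c<n_cells T. \<Sum>f\<in>cell_faces T c. h c f) =
      (\<Sum>c<n_cells T. \<Sum>f\<in>{f\<in>{..<n_faces T}. f \<in> cell_faces T c}. h c f)"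
    using sub by (intro sum.cong) (auto simp: subset_iff)
  also have "\<dots> = (\<Sum>f<n_faces T. \<Sum>c\<in>{c\<in>{..<n_cells T}. f \<in> cell_faces T c}. h c f)"
    by (intro sum.swap_restrict) auto
  also have "\<dots> = (\<Sum>f<n_faces T. \<Sum>c\<in>?adj f. h c f)" by simp
  also have "\<dots> = (\<Sum>f\<in>interfaces T. \<Sum>c\<in>?adj f. h c f) + (\<Sum>f\<in>bdry_faces T. \<Sum>c\<in>?adj f. h c f)"
    unfolding un using fin dis by (intro sum.union_disjoint)
  also have "(\<Sum>f\<in>interfaces T. \<Sum>c\<in>?adj f. h c f) =
      (\<Sum>f\<in>interfaces T. h (neg_cell T f) f + h (pos_cell T f) f)"
    using interface_adjacent_cells[OF assms(2)] by (intro sum.cong) simp_all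
  also have "(\<Sum>f\<in>bdry_faces T. \<Sum>c\<in>?adj f. h c f) = (\<Sum>f\<in>bdry_faces T. h (bdry_cell T f) f)"
    using bdry_face_adjacent_cells[OF assms(1)] by (intro sum.cong) simp_all
  finally show ?thesis .
qed

lemma face_subset_frontier:
  assumes "mesh_faces T" "c < n_cells T" "f \<in> cell_faces T c"
  shows "face T f \<subseteq> frontier (cell T c)"
proof -
  have "frontier (cell T c) = (\<Union>f\<in>cell_faces T c. face T f)"
    using assms(1,2) by (simp add: mesh_faces_def)
  with assms(3) show ?thesis by blast
qed

lemma interface_cells:
  assumes "axis_aligned_interfaces T" "f \<in> interfaces T" "c = neg_cell T f \<or> c = pos_cell T f"
  shows "c < n_cells T" "f \<in> cell_faces T c"
proof -
  have "c \<in> {c. c < n_cells T \<and> f \<in> cell_faces T c}"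
    unfolding interface_adjacent_cells(1)[OF assms(1,2)] using assms(3) by simp
  then show "c < n_cells T" "f \<in> cell_faces T c" by simp_all
qed

lemma bdry_cell_adjacent:
  assumes "mesh_faces T" "f \<in> bdry_faces T"
  shows "bdry_cell T f < n_cells T" "f \<in> cell_faces T (bdry_cell T f)"
proof -
  have "bdry_cell T f \<in> {c. c < n_cells T \<and> f \<in> cell_faces T c}"
    unfolding bdry_face_adjacent_cells[OF assms] by simp
  then show "bdry_cell T f < n_cells T" "f \<in> cell_faces T (bdry_cell T f)" by simp_all
qed

lemma interface_normal_axis:
  assumes "axis_aligned_interfaces T" "f \<in> interfaces T"
  shows "\<exists>m. \<forall>x\<in>face T f.
    has_face_normal (cell T (neg_cell T f)) (face T f) x \<and>
    has_face_normal (cell T (pos_cell T f)) (face T f) x \<and>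
    face_normal (cell T (neg_cell T f)) (face T f) x = axis m 1 \<and>
    face_normal (cell T (pos_cell T f)) (face T f) x = - axis m 1"
proof -
  have "\<exists>m. (\<exists>a. \<forall>x\<in>face T f. x $ m = a) \<and> (\<forall>x\<in>face T f.
      has_face_normal (cell T (neg_cell T f)) (face T f) x \<and>
      has_face_normal (cell T (pos_cell T f)) (face T f) x \<and>
      face_normal (cell T (neg_cell T f)) (face T f) x = axis m 1 \<and>
      face_normal (cell T (pos_cell T f)) (face T f) x = - axis m 1)"
    using assms by (simp add: axis_aligned_interfaces_def)
  then show ?thesis by blast
qed

lemma interface_face_normals_opposite:
  assumes "axis_aligned_interfaces T" "f \<in> interfaces T" "x \<in> face T f"
  shows "has_face_normal (cell T (neg_cell T f)) (face T f) x"
    and "has_face_normal (cell T (pos_cell T f)) (face T f) x"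
    and "face_normal (cell T (pos_cell T f)) (face T f) x =
      - face_normal (cell T (neg_cell T f)) (face T f) x"
  using interface_normal_axis[OF assms(1,2)] assms(3) by auto

lemma interface_normals_opposite:
  assumes "axis_aligned_interfaces T" "f \<in> interfaces T" "x \<in> face T f"
    and n: "is_outward_unit_normal (cell T (neg_cell T f)) x \<nu>"
    and p: "is_outward_unit_normal (cell T (pos_cell T f)) x \<mu>"
  shows "\<mu> = - \<nu>"
  using interface_face_normals_opposite[OF assms(1-3)]
    face_normal_eq_outward_unit_normal[OF _ assms(3) n]
    face_normal_eq_outward_unit_normal[OF _ assms(3) p] by simp


text \<open>
  Each boundary integral splits into face integrals, since faces overlap in null sets only. Those over
  an interface cancel, as its two normals are opposite almost everywhere; on the remaining faces the
  normal of the cell is that of the domain almost everywhere.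
\<close>

lemma sum_cell_boundary_flux:
  fixes T :: "('d::finite, 'z) cut_mesh_scheme"
  assumes mesh: "cut_cell_mesh T" and g: "continuous_on UNIV g"
  shows "(\<Sum>c<n_cells T. LINT y:frontier (cell T c)|surface_measure.
            g y * outward_unit_normal (cell T c) y $ k) =
    (LINT y:frontier (omega T)|surface_measure. g y * outward_unit_normal (omega T) y $ k)"
proof -
  let ?F = "\<lambda>A y. g y * outward_unit_normal A y $ k"
  let ?S = "surface_measure :: (real ^ 'd) measure"
  have faces: "mesh_faces T" and axis: "axis_aligned_interfaces T" and part: "cell_partition T"
    and bdd: "bounded (omega T)" and reg: "regular_boundary (omega T)"
    and regc: "\<And>c. c < n_cells T \<Longrightarrow> regular_boundary (cell T c)"
    using mesh by (auto simp: cut_cell_mesh_def)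
  have [measurable]: "g \<in> borel_measurable borel"
    using g by (rule borel_measurable_continuous_onI)
  have Fm: "(\<lambda>y. indicat_real X y *\<^sub>R ?F A y) \<in> borel_measurable ?S" if "X \<in> sets borel" for X A
    using that by measurable
  have face_sets: "face T f \<in> sets borel" if "f < n_faces T" for f
    using faces that by (simp add: mesh_faces_def borel_closed)
  have lt: "f < n_faces T" if "f \<in> interfaces T \<union> bdry_faces T" for f
  proof -
    have "interfaces T \<union> bdry_faces T = {..<n_faces T}" using faces by (simp add: mesh_faces_def)
    with that show ?thesis by blast
  qed
  have null: "emeasure ?S (face T f \<inter> face T f') = 0"
    if "f < n_faces T" "f' < n_faces T" "f \<noteq> f'" for f f'
    using faces that by (simp add: mesh_faces_def)
  have sub: "cell T c \<subseteq> omega T" if "c < n_cells T" for c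
    using part that by (simp add: cell_partition_def)
  have split: "(LINT y:(\<Union>f\<in>I. face T f)|?S. ?F A y) = (\<Sum>f\<in>I. LINT y:face T f|?S. ?F A y)"
    if "I \<subseteq> {..<n_faces T}" "frontier A = (\<Union>f\<in>I. face T f)" "bounded A" "regular_boundary A" for I A
  proof (rule set_integral_almost_disjoint_UN)
    show "finite I" using that(1) finite_subset by blast
    show "set_integrable ?S (\<Union>f\<in>I. face T f) (?F A)"
      using set_integrable_boundary_flux[OF g that(3)] that(2,4)
      by (simp add: regular_boundary_def)
  qed (use that(1) null in \<open>auto simp: face_sets subset_iff\<close>)
  have cell_split: "(LINT y:frontier (cell T c)|?S. ?F (cell T c) y) =
      (\<Sum>f\<in>cell_faces T c. LINT y:face T f|?S. ?F (cell T c) y)" if c: "c < n_cells T" for c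
  proof -
    have fr: "cell_faces T c \<subseteq> {..<n_faces T}" "frontier (cell T c) = (\<Union>f\<in>cell_faces T c. face T f)"
      using faces c by (simp_all add: mesh_faces_def)
    show ?thesis
      using split[OF fr bounded_subset[OF bdd sub[OF c]] regc[OF c]] unfolding fr(2) .
  qed
  have normal_ae: "AE y in ?S. y \<in> face T f \<longrightarrow>
      is_outward_unit_normal (cell T c) y (outward_unit_normal (cell T c) y)"
    if "c < n_cells T" "f \<in> cell_faces T c" for c f
  proof -
    have "AE y in ?S. y \<in> frontier (cell T c) \<longrightarrow> (\<exists>\<nu>. is_outward_unit_normal (cell T c) y \<nu>)"
      using regc[OF that(1)] by (simp add: regular_boundary_def)
    then show ?thesis
      by eventually_elim (use face_subset_frontier[OF faces that] outward_unit_normal_eq in blast)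
  qed
  have inter: "(LINT y:face T f|?S. ?F (cell T (neg_cell T f)) y) +
      (LINT y:face T f|?S. ?F (cell T (pos_cell T f)) y) = 0" if f: "f \<in> interfaces T" for f
  proof -
    have fs: "face T f \<in> sets borel" using face_sets lt f by blast
    note ad = interface_cells[OF axis f, OF disjI1[OF refl]] interface_cells[OF axis f, OF disjI2[OF refl]]
    have "AE y in ?S. indicat_real (face T f) y *\<^sub>R ?F (cell T (pos_cell T f)) y =
        - (indicat_real (face T f) y *\<^sub>R ?F (cell T (neg_cell T f)) y)"
      using normal_ae[OF ad(1,2)] normal_ae[OF ad(3,4)]
    proof eventually_elim
      case (elim y)
      show ?case
      proof (cases "y \<in> face T f")
        case True
        then have "outward_unit_normal (cell T (pos_cell T f)) y =
            - outward_unit_normal (cell T (neg_cell T f)) y"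
          using elim by (intro interface_normals_opposite[OF axis f True]) simp_all
        then show ?thesis by simp
      qed simp
    qed
    then have "(LINT y:face T f|?S. ?F (cell T (pos_cell T f)) y) =
        (LINT y|?S. - (indicat_real (face T f) y *\<^sub>R ?F (cell T (neg_cell T f)) y))"
      unfolding set_lebesgue_integral_def
      by (intro integral_cong_AE borel_measurable_uminus Fm fs)
    then show ?thesis by (simp add: set_lebesgue_integral_def)
  qed
  have fr_omega: "frontier (omega T) = (\<Union>f\<in>bdry_faces T. face T f)"
    using faces by (simp add: mesh_faces_def)
  have bdry: "(LINT y:face T f|?S. ?F (cell T (bdry_cell T f)) y) =
      (LINT y:face T f|?S. ?F (omega T) y)" if f: "f \<in> bdry_faces T" for f
  proof -
    have fs: "face T f \<in> sets borel" using face_sets lt f by blast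
    note ad = bdry_cell_adjacent[OF faces f]
    have "face T f \<subseteq> frontier (omega T)"
      using fr_omega f by blast
    moreover have "AE y in ?S. y \<in> frontier (omega T) \<longrightarrow> (\<exists>\<nu>. is_outward_unit_normal (omega T) y \<nu>)"
      using reg by (simp add: regular_boundary_def)
    ultimately have "AE y in ?S. y \<in> face T f \<longrightarrow> (\<exists>\<nu>. is_outward_unit_normal (omega T) y \<nu>)"
      by (auto elim: eventually_mono)
    with normal_ae[OF ad] have "AE y in ?S. indicat_real (face T f) y *\<^sub>R ?F (cell T (bdry_cell T f)) y =
        indicat_real (face T f) y *\<^sub>R ?F (omega T) y"
    proof eventually_elim
      case (elim y)
      show ?case
      proof (cases "y \<in> face T f")
        case True
        then obtain \<nu> where "is_outward_unit_normal (omega T) y \<nu>" using elim by blast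
        with True elim outward_unit_normal_subset[OF _ this sub[OF ad(1)]] outward_unit_normal_eq[OF this]
        show ?thesis by simp
      qed simp
    qed
    then show ?thesis
      unfolding set_lebesgue_integral_def
      by (intro integral_cong_AE borel_measurable_uminus Fm fs)
  qed
  have "(\<Sum>c<n_cells T. LINT y:frontier (cell T c)|?S. ?F (cell T c) y) =
      (\<Sum>c<n_cells T. \<Sum>f\<in>cell_faces T c. LINT y:face T f|?S. ?F (cell T c) y)"
    using cell_split by (intro sum.cong) auto
  also have "\<dots> = (\<Sum>f\<in>bdry_faces T. LINT y:face T f|?S. ?F (omega T) y)"
    unfolding sum_cells_faces[OF faces axis] using inter bdry by simp
  also have "\<dots> = (LINT y:frontier (omega T)|?S. ?F (omega T) y)"
  proof -
    have "bdry_faces T \<subseteq> {..<n_faces T}" using lt by blast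
    then show ?thesis using split[OF _ fr_omega bdd reg] unfolding fr_omega by simp
  qed
  finally show ?thesis .
qed

section \<open>Face terms\<close>

text \<open>
  All boundary and interface contributions have this shape. When the columns of \<open>X\<close> and \<open>Y\<close> hold values
  of functions \<open>u\<close> and \<open>v\<close> at the quadrature nodes of \<open>f\<close>, the entries are the quadrature values of
  \<open>u v n\<close>, where \<open>n\<close> is the \<open>k\<close>-th component of the normal outward from \<open>c\<close>.
\<close>

definition face_form ::
  "'d \<Rightarrow> ('d::finite, 'z) sbp_mesh_scheme \<Rightarrow> nat \<Rightarrow> nat \<Rightarrow> real mat \<Rightarrow> real mat \<Rightarrow> real mat" where
  "face_form k T f c X Y = X\<^sup>T * B_mat T f * N_cell k T f c * Y"

lemma B_mat_carrier [simp]: "B_mat T f \<in> carrier_mat (n_quad T f) (n_quad T f)"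
  by (simp add: B_mat_def)

lemma N_cell_carrier [simp]: "N_cell k T f c \<in> carrier_mat (n_quad T f) (n_quad T f)"
  by (simp add: N_cell_def)

lemma face_form_carrier [simp]:
  "X \<in> carrier_mat (n_quad T f) a \<Longrightarrow> Y \<in> carrier_mat (n_quad T f) b \<Longrightarrow>
    face_form k T f c X Y \<in> carrier_mat a b"
  unfolding face_form_def by (intro mult_carrier_mat[of _ _ "n_quad T f"]) auto

lemma face_form_index:
  assumes X: "X \<in> carrier_mat (n_quad T f) a" and Y: "Y \<in> carrier_mat (n_quad T f) b"
    and ij: "i < a" "j < b"
  shows "face_form k T f c X Y $$ (i, j) = (\<Sum>q<n_quad T f. quad_weight T f q *
    (face_normal (cell T c) (face T f) (quad_node T f q) $ k) * X $$ (q, i) * Y $$ (q, j))"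
proof -
  have "X\<^sup>T * B_mat T f * N_cell k T f c = X\<^sup>T * (B_mat T f * N_cell k T f c)"
    by (rule assoc_mult_mat[of _ a "n_quad T f" _ "n_quad T f" _ "n_quad T f"]) (use X in simp_all)
  then show ?thesis
    unfolding face_form_def
    by (simp add: B_mat_def N_cell_def transpose_mat_diag_mult_index[OF X Y ij])
qed

lemma transpose_face_form:
  assumes X: "X \<in> carrier_mat (n_quad T f) a" and Y: "Y \<in> carrier_mat (n_quad T f) b"
  shows "(face_form k T f c X Y)\<^sup>T = face_form k T f c Y X"
proof (rule eq_matI)
  note c = carrier_matD[OF face_form_carrier[OF X Y]] carrier_matD[OF face_form_carrier[OF Y X]]
  fix i j assume "i < dim_row (face_form k T f c Y X)" "j < dim_col (face_form k T f c Y X)"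
  then have ij: "i < b" "j < a" by (simp_all add: c)
  then have "(face_form k T f c X Y)\<^sup>T $$ (i, j) = face_form k T f c X Y $$ (j, i)"
    by (simp add: c)
  then show "(face_form k T f c X Y)\<^sup>T $$ (i, j) = face_form k T f c Y X $$ (i, j)"
    by (simp add: face_form_index[OF X Y ij(2,1)] face_form_index[OF Y X ij] mult_ac)
qed (simp_all add: carrier_matD[OF face_form_carrier[OF X Y]] carrier_matD[OF face_form_carrier[OF Y X]])

lemma face_form_mult_right:
  assumes "X \<in> carrier_mat (n_quad T f) a" "Y \<in> carrier_mat (n_quad T f) b" "Z \<in> carrier_mat b l"
  shows "face_form k T f c X Y * Z = face_form k T f c X (Y * Z)"
  unfolding face_form_def
  by (rule assoc_mult_mat[OF _ assms(2,3)], intro mult_carrier_mat[of _ _ "n_quad T f"])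
     (use assms in simp_all)

lemma face_form_mult_left:
  assumes X: "X \<in> carrier_mat (n_quad T f) a" and Y: "Y \<in> carrier_mat (n_quad T f) b"
    and Z: "Z \<in> carrier_mat a l"
  shows "Z\<^sup>T * face_form k T f c X Y = face_form k T f c (X * Z) Y"
proof -
  have "(Z\<^sup>T * face_form k T f c X Y)\<^sup>T = face_form k T f c Y X * Z"
    using transpose_mult[of "Z\<^sup>T" l a "face_form k T f c X Y" b] X Y Z
    by (simp add: transpose_face_form[OF X Y])
  also have "\<dots> = (face_form k T f c (X * Z) Y)\<^sup>T"
    using X Y Z by (simp add: face_form_mult_right[OF Y X Z] transpose_face_form[of _ T f l _ b])
  finally show ?thesis by (simp only: transpose_mat_eq)
qed

lemma transpose_mat_sum_face_form:
  assumes "\<And>f. f \<in> I \<Longrightarrow> X f \<in> carrier_mat (n_quad T f) a"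
    and "\<And>f. f \<in> I \<Longrightarrow> Y f \<in> carrier_mat (n_quad T f) b"
  shows "(mat_sum a b (\<lambda>f. face_form k T f (c f) (X f) (Y f)) I)\<^sup>T =
    mat_sum b a (\<lambda>f. face_form k T f (c f) (Y f) (X f)) I"
proof -
  have "(mat_sum a b (\<lambda>f. face_form k T f (c f) (X f) (Y f)) I)\<^sup>T =
      mat_sum b a (\<lambda>f. (face_form k T f (c f) (X f) (Y f))\<^sup>T) I"
    by (rule transpose_mat_sum) (rule face_form_carrier[OF assms])
  also have "\<dots> = mat_sum b a (\<lambda>f. face_form k T f (c f) (Y f) (X f)) I"
    by (rule mat_sum_cong) (rule transpose_face_form[OF assms])
  finally show ?thesis .
qed

text \<open>
  Passing the factor \<open>Z\<close> to the face values lets the identity \<open>R V = V\<^sup>f\<close> be applied inside the sum.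
\<close>

lemma mat_sum_face_form_mult:
  assumes X: "\<And>f. f \<in> I \<Longrightarrow> X f \<in> carrier_mat (n_quad T f) a"
    and Y: "\<And>f. f \<in> I \<Longrightarrow> Y f \<in> carrier_mat (n_quad T f) b"
    and Z: "Z \<in> carrier_mat b l"
    and YZ: "\<And>f. f \<in> I \<Longrightarrow> Y f * Z = Y' f"
  shows "mat_sum a b (\<lambda>f. face_form k T f (c f) (X f) (Y f)) I * Z =
    mat_sum a l (\<lambda>f. face_form k T f (c f) (X f) (Y' f)) I"
proof -
  have "mat_sum a b (\<lambda>f. face_form k T f (c f) (X f) (Y f)) I * Z =
      mat_sum a l (\<lambda>f. face_form k T f (c f) (X f) (Y f) * Z) I"
    by (rule mat_sum_mult[OF Z]) (rule face_form_carrier[OF X Y])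
  also have "\<dots> = mat_sum a l (\<lambda>f. face_form k T f (c f) (X f) (Y' f)) I"
    by (rule mat_sum_cong) (simp add: face_form_mult_right[OF X Y Z] YZ)
  finally show ?thesis .
qed

lemma mult_mat_sum_face_form:
  assumes X: "\<And>f. f \<in> I \<Longrightarrow> X f \<in> carrier_mat (n_quad T f) a"
    and Y: "\<And>f. f \<in> I \<Longrightarrow> Y f \<in> carrier_mat (n_quad T f) b"
    and Z: "Z \<in> carrier_mat a l"
    and XZ: "\<And>f. f \<in> I \<Longrightarrow> X f * Z = X' f"
  shows "Z\<^sup>T * mat_sum a b (\<lambda>f. face_form k T f (c f) (X f) (Y f)) I =
    mat_sum l b (\<lambda>f. face_form k T f (c f) (X' f) (Y f)) I"
proof -
  have "Z\<^sup>T * mat_sum a b (\<lambda>f. face_form k T f (c f) (X f) (Y f)) I =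
      mat_sum l b (\<lambda>f. Z\<^sup>T * face_form k T f (c f) (X f) (Y f)) I"
    by (rule mult_mat_sum) (use Z in simp, rule face_form_carrier[OF X Y])
  also have "\<dots> = mat_sum l b (\<lambda>f. face_form k T f (c f) (X' f) (Y f)) I"
    by (rule mat_sum_cong) (simp add: face_form_mult_left[OF X Y Z] XZ)
  finally show ?thesis .
qed

text \<open>
  Only the normal depends on the side from which an interface is seen.
\<close>

lemma face_form_opposite:
  assumes axis: "axis_aligned_interfaces T" and f: "f \<in> interfaces T"
    and quad: "\<And>q. q < n_quad T f \<Longrightarrow> quad_node T f q \<in> face T f"
    and X: "X \<in> carrier_mat (n_quad T f) a" and Y: "Y \<in> carrier_mat (n_quad T f) b"
    and ij: "i < a" "j < b"
  shows "face_form k T f (pos_cell T f) X Y $$ (i, j) = - face_form k T f (neg_cell T f) X Y $$ (i, j)"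
  unfolding face_form_index[OF X Y ij] sum_negf[symmetric]
  by (intro sum.cong refl) (simp add: interface_face_normals_opposite(3)[OF axis f quad])


section \<open>Restriction to stencils and interpolation to faces\<close>

lemma vandermonde_carrier [simp]:
  "vandermonde p V m x \<in> carrier_mat m (poly_dim TYPE('d::finite) p)" for x :: "nat \<Rightarrow> real ^ 'd"
  by (simp add: vandermonde_def)

lemma vandermonde_deriv_carrier [simp]:
  "vandermonde_deriv k p V m x \<in> carrier_mat m (poly_dim TYPE('d::finite) p)" for x :: "nat \<Rightarrow> real ^ 'd"
  by (simp add: vandermonde_deriv_def)

lemma P_mat_carrier [simp]: "P_mat T c \<in> carrier_mat (stencil_size T c) (n_nodes T)"
  by (simp add: P_mat_def)

text \<open>
  Selecting the rows of a stencil, for any matrix whose rows are indexed by nodes. It serves both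
  Vandermonde matrices.
\<close>

lemma P_mat_mult_node_mat:
  assumes "set (stencil T c) \<subseteq> {..<n_nodes T}"
  shows "P_mat T c * Matrix.mat (n_nodes T) K (\<lambda>(i, j). h j (node T i)) =
    Matrix.mat (stencil_size T c) K (\<lambda>(i, j). h j (stencil_node T c i))"
proof (rule eq_matI)
  fix i j
  assume "i < dim_row (Matrix.mat (stencil_size T c) K (\<lambda>(i, j). h j (stencil_node T c i)))"
    "j < dim_col (Matrix.mat (stencil_size T c) K (\<lambda>(i, j). h j (stencil_node T c i)))"
  then have ij: "i < stencil_size T c" "j < K" by simp_all
  then have lt: "stencil T c ! i < n_nodes T"
    using assms by (auto simp: stencil_size_def subset_iff)
  have "(P_mat T c * Matrix.mat (n_nodes T) K (\<lambda>(i, j). h j (node T i))) $$ (i, j) =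
      (\<Sum>l<n_nodes T. if l = stencil T c ! i then h j (node T l) else 0)"
    using ij by (simp add: P_mat_def scalar_prod_def atLeast0LessThan if_distrib if_distribR cong: if_cong)
  also have "\<dots> = h j (stencil_node T c i)" using lt by (simp add: stencil_node_def)
  finally show "(P_mat T c * Matrix.mat (n_nodes T) K (\<lambda>(i, j). h j (node T i))) $$ (i, j) =
      Matrix.mat (stencil_size T c) K (\<lambda>(i, j). h j (stencil_node T c i)) $$ (i, j)"
    using ij by simp
qed (simp_all add: P_mat_def)

lemma P_mat_mult_vandermonde:
  assumes "set (stencil T c) \<subseteq> {..<n_nodes T}"
  shows "P_mat T c * vandermonde p V (n_nodes T) (node T) =
    vandermonde p V (stencil_size T c) (stencil_node T c)"
  unfolding vandermonde_def using P_mat_mult_node_mat[OF assms] .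

lemma P_mat_mult_vandermonde_deriv:
  assumes "set (stencil T c) \<subseteq> {..<n_nodes T}"
  shows "P_mat T c * vandermonde_deriv k p V (n_nodes T) (node T) =
    vandermonde_deriv k p V (stencil_size T c) (stencil_node T c)"
  unfolding vandermonde_deriv_def
  using P_mat_mult_node_mat[OF assms, of _ "\<lambda>j x. frechet_derivative (V j) (at x) (axis k 1)"] .

text \<open>
  A row of \<open>P\<close> has a single nonzero entry, so no row meets two different columns.
\<close>

lemma P_mat_diagonal_congruence:
  assumes D: "diagonal_mat D" "D \<in> carrier_mat (stencil_size T c) (stencil_size T c)"
    and ij: "i < n_nodes T" "j < n_nodes T" "i \<noteq> j"
  shows "((P_mat T c)\<^sup>T * D * P_mat T c) $$ (i, j) = 0"
proof -
  have "((P_mat T c)\<^sup>T * mat_diag (stencil_size T c) (\<lambda>i. D $$ (i, i)) * P_mat T c) $$ (i, j) =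
      (\<Sum>q<stencil_size T c. D $$ (q, q) * P_mat T c $$ (q, i) * P_mat T c $$ (q, j))"
    by (rule transpose_mat_diag_mult_index) (use ij in simp_all)
  also have "\<dots> = 0" using ij by (intro sum.neutral) (auto simp: P_mat_def)
  finally show ?thesis using diagonal_mat_eq_mat_diag[OF D] by simp
qed

lemma pseudoinverse_vandermonde:
  fixes x :: "nat \<Rightarrow> real ^ 'd::finite"
  assumes "full_column_rank (vandermonde p V m x)"
  shows "pseudoinverse (vandermonde p V m x) \<in> carrier_mat (poly_dim TYPE('d) p) m"
    and "pseudoinverse (vandermonde p V m x) * vandermonde p V m x = 1\<^sub>m (poly_dim TYPE('d) p)"
  using pseudoinverse_left_inverse[OF assms] by (simp_all add: vandermonde_def)

lemma R_cell_carrier: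
  assumes "full_column_rank (vandermonde p V (stencil_size T c) (stencil_node T c))"
  shows "R_cell p V T f c \<in> carrier_mat (n_quad T f) (stencil_size T c)"
  unfolding R_cell_def
  by (rule mult_carrier_mat[OF vandermonde_carrier pseudoinverse_vandermonde(1)[OF assms]])

text \<open>
  Exactness of the interpolation: the left factor no longer remembers the stencil.
\<close>

lemma R_cell_mult_vandermonde:
  assumes "full_column_rank (vandermonde p V (stencil_size T c) (stencil_node T c))"
  shows "R_cell p V T f c * vandermonde p V (stencil_size T c) (stencil_node T c) =
    vandermonde p V (n_quad T f) (quad_node T f)"
  unfolding R_cell_def
  by (simp add: assoc_mult_mat[OF vandermonde_carrier pseudoinverse_vandermonde(1)[OF assms]
      vandermonde_carrier] pseudoinverse_vandermonde(2)[OF assms] right_mult_one_mat[OF vandermonde_carrier])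

section \<open>Assembly of the global pair\<close>

theorem theorem4:
  fixes T :: "('d::finite) sbp_mesh"
    and k :: 'd
    and p :: nat
    and V :: "nat \<Rightarrow> real ^ 'd \<Rightarrow> real"
    and Mc Qc Sc Ec :: "nat \<Rightarrow> real mat"
    and M S E :: "real mat"
  assumes p: "p \<ge> 1"
    and basis: "poly_basis p V"
    and mesh: "cut_cell_mesh T"
    and stencils: "valid_stencils p V T"
    and quadratures: "valid_quadratures p T"
    and cell_SBP: "\<And>c. c < n_cells T \<Longrightarrow>
      degenerate_SBP_pair k p V (cell T c) (stencil_size T c) (stencil_node T c) (Mc c) (Qc c)"
    and cell_S_carrier: "\<And>c. c < n_cells T \<Longrightarrow>
      Sc c \<in> carrier_mat (stencil_size T c) (stencil_size T c)"
    and cell_S_skew: "\<And>c. c < n_cells T \<Longrightarrow> skew_symmetric_mat (Sc c)"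
    and cell_Q: "\<And>c. c < n_cells T \<Longrightarrow> Qc c = Sc c + (1 / 2) \<cdot>\<^sub>m Ec c"
    and cell_E: "\<And>c. c < n_cells T \<Longrightarrow>
      Ec c = mat_sum (stencil_size T c) (stencil_size T c)
        (\<lambda>f. (R_cell p V T f c)\<^sup>T * B_mat T f * N_cell k T f c * R_cell p V T f c)
        (cell_faces T c)"
    and M: "M = mat_sum (n_nodes T) (n_nodes T)
        (\<lambda>c. (P_mat T c)\<^sup>T * Mc c * P_mat T c) {..<n_cells T}"
    and E: "E = mat_sum (n_nodes T) (n_nodes T)
        (\<lambda>f. (R_bdry p V T f)\<^sup>T * B_mat T f * N_face k T f * R_bdry p V T f) (bdry_faces T)"
    and S: "S = mat_sum (n_nodes T) (n_nodes T)
          (\<lambda>c. (P_mat T c)\<^sup>T * Sc c * P_mat T c) {..<n_cells T}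
        + (1 / 2) \<cdot>\<^sub>m mat_sum (n_nodes T) (n_nodes T)
            (\<lambda>f. (R_neg p V T f)\<^sup>T * B_mat T f * N_face k T f * R_pos p V T f) (interfaces T)
        - (1 / 2) \<cdot>\<^sub>m mat_sum (n_nodes T) (n_nodes T)
            (\<lambda>f. (R_pos p V T f)\<^sup>T * B_mat T f * N_face k T f * R_neg p V T f) (interfaces T)"
  shows "degenerate_SBP_pair k p V (omega T) (n_nodes T) (node T) M (S + (1 / 2) \<cdot>\<^sub>m E)"
proof -
  let ?n = "n_nodes T" and ?K = "poly_dim TYPE('d) p" and ?s = "stencil_size T"
  let ?W = "vandermonde p V ?n (node T)" and ?W' = "vandermonde_deriv k p V ?n (node T)"
  let ?Vc = "\<lambda>c. vandermonde p V (?s c) (stencil_node T c)"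
  let ?Vc' = "\<lambda>c. vandermonde_deriv k p V (?s c) (stencil_node T c)"
  let ?Vf = "\<lambda>f. vandermonde p V (n_quad T f) (quad_node T f)"
  let ?R = "\<lambda>f c. R_cell p V T f c * P_mat T c"
  let ?F = "face_form k T"
  have faces: "mesh_faces T" and axis: "axis_aligned_interfaces T"
    using mesh by (simp_all add: cut_cell_mesh_def)
  have ind: "set (stencil T c) \<subseteq> {..<?n}" and rank: "full_column_rank (?Vc c)"
    if "c < n_cells T" for c
    using stencils that by (simp_all add: valid_stencils_def)
  have Rc [simp]: "R_cell p V T f c \<in> carrier_mat (n_quad T f) (?s c)" if "c < n_cells T" for f c
    using R_cell_carrier[OF rank[OF that]] .
  have R [simp]: "?R f c \<in> carrier_mat (n_quad T f) ?n" if "c < n_cells T" for f c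
    by (rule mult_carrier_mat[OF Rc[OF that] P_mat_carrier])
  have RW: "?R f c * ?W = ?Vf f" if c: "c < n_cells T" for f c
    by (simp add: assoc_mult_mat[OF Rc[OF c] P_mat_carrier vandermonde_carrier]
        P_mat_mult_vandermonde[OF ind[OF c]] R_cell_mult_vandermonde[OF rank[OF c]])
  \<comment> \<open>the quadrature nodes lie on the face, where the interface normals are known\<close>
  have quad: "quad_node T f q \<in> face T f" if "f \<in> interfaces T" "q < n_quad T f" for f q
  proof -
    have "interfaces T \<union> bdry_faces T = {..<n_faces T}" using faces by (simp add: mesh_faces_def)
    then have "f < n_faces T" using that(1) by blast
    then show ?thesis using quadratures that(2) by (simp add: valid_quadratures_def)
  qed
  have neg: "neg_cell T f < n_cells T" and pos: "pos_cell T f < n_cells T"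
    if "f \<in> interfaces T" for f
    using interface_cells(1)[OF axis that] by simp_all
  have bc: "bdry_cell T f < n_cells T" if "f \<in> bdry_faces T" for f
    using bdry_cell_adjacent(1)[OF faces that] .
  have nb: "f \<notin> interfaces T" if "f \<in> bdry_faces T" for f
  proof -
    have "interfaces T \<inter> bdry_faces T = {}" using faces by (simp add: mesh_faces_def)
    with that show ?thesis by blast
  qed

  have E': "E = mat_sum ?n ?n (\<lambda>f. ?F f (bdry_cell T f) (?R f (bdry_cell T f)) (?R f (bdry_cell T f)))
      (bdry_faces T)"
    unfolding E using nb by (intro mat_sum_cong) (simp add: face_form_def R_bdry_def N_face_def)
  have SN: "mat_sum ?n ?n (\<lambda>f. (R_neg p V T f)\<^sup>T * B_mat T f * N_face k T f * R_pos p V T f) (interfaces T)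
      = mat_sum ?n ?n (\<lambda>f. ?F f (neg_cell T f) (?R f (neg_cell T f)) (?R f (pos_cell T f))) (interfaces T)"
    by (intro mat_sum_cong) (simp add: face_form_def R_neg_def R_pos_def N_face_def)
  have SP: "mat_sum ?n ?n (\<lambda>f. (R_pos p V T f)\<^sup>T * B_mat T f * N_face k T f * R_neg p V T f) (interfaces T)
      = mat_sum ?n ?n (\<lambda>f. ?F f (neg_cell T f) (?R f (pos_cell T f)) (?R f (neg_cell T f))) (interfaces T)"
    by (intro mat_sum_cong) (simp add: face_form_def R_neg_def R_pos_def N_face_def)
  have Ec: "Ec c = mat_sum (?s c) (?s c) (\<lambda>f. ?F f c (R_cell p V T f c) (R_cell p V T f c)) (cell_faces T c)"
    if "c < n_cells T" for c
    using cell_E[OF that] by (simp add: face_form_def)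
  define A where "A = mat_sum ?n ?n (\<lambda>c. (P_mat T c)\<^sup>T * Sc c * P_mat T c) {..<n_cells T}"
  define B where "B = mat_sum ?n ?n
    (\<lambda>f. ?F f (neg_cell T f) (?R f (neg_cell T f)) (?R f (pos_cell T f))) (interfaces T)"
  define C where "C = mat_sum ?n ?n
    (\<lambda>f. ?F f (neg_cell T f) (?R f (pos_cell T f)) (?R f (neg_cell T f))) (interfaces T)"
  have S': "S = A + (1 / 2) \<cdot>\<^sub>m B - (1 / 2) \<cdot>\<^sub>m C"
    unfolding S SN SP A_def B_def C_def ..
  have carr [simp]: "A \<in> carrier_mat ?n ?n" "B \<in> carrier_mat ?n ?n" "C \<in> carrier_mat ?n ?n"
    "S \<in> carrier_mat ?n ?n" "E \<in> carrier_mat ?n ?n" "M \<in> carrier_mat ?n ?n"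
    unfolding S' A_def B_def C_def E' M
    by (intro minus_carrier_mat smult_carrier_mat mat_sum_carrier)+
  have PSP: "(P_mat T c)\<^sup>T * Sc c * P_mat T c \<in> carrier_mat ?n ?n" if "c < n_cells T" for c
    by (intro mult_carrier_mat[of _ _ "?s c"] cell_S_carrier that) simp_all

  have symE: "symmetric_mat E"
    unfolding symmetric_mat_def E' by (rule transpose_mat_sum_face_form; intro R bc)
  have CT: "B\<^sup>T = C" unfolding B_def C_def by (rule transpose_mat_sum_face_form; intro R neg pos)
  have skewS: "skew_symmetric_mat S"
    unfolding S' CT[symmetric] using carr(1,2)
  proof (intro skew_symmetric_mat_add_antisymmetrised)
    show "skew_symmetric_mat A"
      unfolding A_def using PSP cell_S_skew cell_S_carrier
      by (intro skew_symmetric_mat_sum skew_symmetric_mat_congruence[OF _ _ P_mat_carrier]) simp_all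
  qed

  have diagM: "diagonal_mat M"
    unfolding diagonal_mat_def
  proof (intro allI impI)
    fix i j assume "i < dim_row M" "j < dim_col M" and ne: "i \<noteq> j"
    then have ij: "i < ?n" "j < ?n" using carrier_matD[OF carr(6)] by simp_all
    have "((P_mat T c)\<^sup>T * Mc c * P_mat T c) $$ (i, j) = 0" if "c < n_cells T" for c
      using cell_SBP[OF that] ij ne
      by (intro P_mat_diagonal_congruence) (simp_all add: degenerate_SBP_pair_def)
    then show "M $$ (i, j) = 0" using ij by (simp add: M)
  qed

  \<comment> \<open>on polynomials, the right interpolation factor of a cell's face terms becomes the exact face values\<close>
  have EcV: "Ec c * ?Vc c = mat_sum (?s c) ?K (\<lambda>f. ?F f c (R_cell p V T f c) (?Vf f)) (cell_faces T c)"
    if c: "c < n_cells T" for c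
    unfolding Ec[OF c]
    by (rule mat_sum_face_form_mult[OF Rc[OF c] Rc[OF c] vandermonde_carrier
        R_cell_mult_vandermonde[OF rank[OF c]]])

  have accuracy: "(S + (1 / 2) \<cdot>\<^sub>m E) * ?W = M * ?W'"
  proof (rule eq_matI)
    fix i j assume "i < dim_row (M * ?W')" "j < dim_col (M * ?W')"
    then have ij: "i < ?n" "j < ?K"
      using carrier_matD[OF carr(6)] by (simp_all add: vandermonde_deriv_def)
    let ?h = "\<lambda>c f. ?F f c (?R f c) (?Vf f) $$ (i, j)"
    let ?a = "\<lambda>c. ((P_mat T c)\<^sup>T * Sc c * P_mat T c * ?W) $$ (i, j)"
    \<comment> \<open>the accuracy condition of a single cell, scattered to the global nodes\<close>
    have cell: "((P_mat T c)\<^sup>T * Mc c * P_mat T c * ?W') $$ (i, j) =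
        ?a c + (\<Sum>f\<in>cell_faces T c. ?h c f) / 2" if c: "c < n_cells T" for c
    proof -
      have Mcc: "Mc c \<in> carrier_mat (?s c) (?s c)" and acc: "Qc c * ?Vc c = Mc c * ?Vc' c"
        using cell_SBP[OF c] by (simp_all add: degenerate_SBP_pair_def)
      note Scc = cell_S_carrier[OF c]
      have Ecc: "Ec c \<in> carrier_mat (?s c) (?s c)" by (simp add: Ec[OF c])
      note pull = congruence_mult_assoc[OF P_mat_carrier]
      have SV: "Sc c * ?Vc c \<in> carrier_mat (?s c) ?K" and EV: "Ec c * ?Vc c \<in> carrier_mat (?s c) ?K"
        using mult_carrier_mat[OF Scc vandermonde_carrier] mult_carrier_mat[OF Ecc vandermonde_carrier] .
      have PT: "(P_mat T c)\<^sup>T \<in> carrier_mat ?n (?s c)" by simp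
      have "(P_mat T c)\<^sup>T * Mc c * P_mat T c * ?W' = (P_mat T c)\<^sup>T * (Qc c * ?Vc c)"
        by (simp add: pull[OF Mcc vandermonde_deriv_carrier] P_mat_mult_vandermonde_deriv[OF ind[OF c]] acc)
      also have "Qc c * ?Vc c = Sc c * ?Vc c + (1 / 2) \<cdot>\<^sub>m (Ec c * ?Vc c)"
        unfolding cell_Q[OF c] by (rule add_smult_mult_mat[OF Scc Ecc vandermonde_carrier])
      also have "(P_mat T c)\<^sup>T * \<dots> = (P_mat T c)\<^sup>T * (Sc c * ?Vc c) +
          (1 / 2) \<cdot>\<^sub>m ((P_mat T c)\<^sup>T * (Ec c * ?Vc c))"
        by (rule mult_add_smult_mat[OF PT SV EV])
      also have "(P_mat T c)\<^sup>T * (Sc c * ?Vc c) = (P_mat T c)\<^sup>T * Sc c * P_mat T c * ?W"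
        by (simp add: pull[OF Scc vandermonde_carrier] P_mat_mult_vandermonde[OF ind[OF c]])
      also have "(P_mat T c)\<^sup>T * (Ec c * ?Vc c) =
          mat_sum ?n ?K (\<lambda>f. ?F f c (?R f c) (?Vf f)) (cell_faces T c)"
        unfolding EcV[OF c]
        by (rule mult_mat_sum_face_form[OF Rc[OF c] vandermonde_carrier P_mat_carrier refl])
      finally have eq: "(P_mat T c)\<^sup>T * Mc c * P_mat T c * ?W' = (P_mat T c)\<^sup>T * Sc c * P_mat T c * ?W
          + (1 / 2) \<cdot>\<^sub>m mat_sum ?n ?K (\<lambda>f. ?F f c (?R f c) (?Vf f)) (cell_faces T c)" .
      have "(P_mat T c)\<^sup>T * Sc c * P_mat T c * ?W \<in> carrier_mat ?n ?K"
        by (rule mult_carrier_mat[OF PSP[OF c] vandermonde_carrier])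
      then show ?thesis unfolding eq using ij by (simp add: mat_sum_def)
    qed
    have MW: "(M * ?W') $$ (i, j) = (\<Sum>c<n_cells T. ?a c + (\<Sum>f\<in>cell_faces T c. ?h c f) / 2)"
    proof -
      have "M * ?W' = mat_sum ?n ?K (\<lambda>c. (P_mat T c)\<^sup>T * Mc c * P_mat T c * ?W') {..<n_cells T}"
        unfolding M
      proof (rule mat_sum_mult[OF vandermonde_deriv_carrier])
        fix c assume "c \<in> {..<n_cells T}"
        then show "(P_mat T c)\<^sup>T * Mc c * P_mat T c \<in> carrier_mat ?n ?n"
          using cell_SBP[of c] by (intro mult_carrier_mat[of _ _ "?s c"]) (simp_all add: degenerate_SBP_pair_def)
      qed
      then show ?thesis using cell ij by simp
    qed
    have AW: "(A * ?W) $$ (i, j) = (\<Sum>c<n_cells T. ?a c)"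
      unfolding A_def
      by (subst mat_sum_mult[OF vandermonde_carrier]) (use PSP ij in simp_all)
    have BW: "(B * ?W) $$ (i, j) = (\<Sum>f\<in>interfaces T. ?h (neg_cell T f) f)"
      unfolding B_def using ij
      by (subst mat_sum_face_form_mult[OF R[OF neg] R[OF pos] vandermonde_carrier RW[OF pos]]) simp_all
    \<comment> \<open>the normal in \<open>C\<close> is that of the negative cell; seen from the positive cell it changes sign\<close>
    have CW: "(C * ?W) $$ (i, j) = - (\<Sum>f\<in>interfaces T. ?h (pos_cell T f) f)"
    proof -
      have "(C * ?W) $$ (i, j) =
          (\<Sum>f\<in>interfaces T. ?F f (neg_cell T f) (?R f (pos_cell T f)) (?Vf f) $$ (i, j))"
        unfolding C_def using ij
        by (subst mat_sum_face_form_mult[OF R[OF pos] R[OF neg] vandermonde_carrier RW[OF neg]]) simp_all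
      also have "\<dots> = (\<Sum>f\<in>interfaces T. - ?h (pos_cell T f) f)"
        using face_form_opposite[OF axis _ quad R[OF pos] vandermonde_carrier ij] by (intro sum.cong) auto
      finally show ?thesis by (simp add: sum_negf)
    qed
    have EW: "(E * ?W) $$ (i, j) = (\<Sum>f\<in>bdry_faces T. ?h (bdry_cell T f) f)"
      unfolding E' using ij
      by (subst mat_sum_face_form_mult[OF R[OF bc] R[OF bc] vandermonde_carrier RW[OF bc]]) simp_all
    have comb: "(W1 + (1 / 2) \<cdot>\<^sub>m W2 - (1 / 2) \<cdot>\<^sub>m W3 + (1 / 2) \<cdot>\<^sub>m W4) $$ (i, j) =
        W1 $$ (i, j) + W2 $$ (i, j) / 2 - W3 $$ (i, j) / 2 + W4 $$ (i, j) / 2"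
      if "W1 \<in> carrier_mat ?n ?K" "W2 \<in> carrier_mat ?n ?K" "W3 \<in> carrier_mat ?n ?K"
        "W4 \<in> carrier_mat ?n ?K" for W1 W2 W3 W4 :: "real mat"
      using that ij by simp
    have "(S + (1 / 2) \<cdot>\<^sub>m E) * ?W =
        A * ?W + (1 / 2) \<cdot>\<^sub>m (B * ?W) - (1 / 2) \<cdot>\<^sub>m (C * ?W) + (1 / 2) \<cdot>\<^sub>m (E * ?W)"
    proof -
      have AB: "A + (1 / 2) \<cdot>\<^sub>m B \<in> carrier_mat ?n ?n" by simp
      show ?thesis
        unfolding add_smult_mult_mat[OF carr(4,5) vandermonde_carrier] unfolding S'
        unfolding minus_smult_mult_mat[OF AB carr(3) vandermonde_carrier]
          add_smult_mult_mat[OF carr(1,2) vandermonde_carrier] ..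
    qed
    then have "((S + (1 / 2) \<cdot>\<^sub>m E) * ?W) $$ (i, j) = (A * ?W) $$ (i, j) + (B * ?W) $$ (i, j) / 2
        - (C * ?W) $$ (i, j) / 2 + (E * ?W) $$ (i, j) / 2"
      using comb[OF mult_carrier_mat[OF carr(1) vandermonde_carrier] mult_carrier_mat[OF carr(2) vandermonde_carrier]
        mult_carrier_mat[OF carr(3) vandermonde_carrier] mult_carrier_mat[OF carr(5) vandermonde_carrier]]
      by (simp only:)
    also have "\<dots> = (\<Sum>c<n_cells T. ?a c) + (\<Sum>c<n_cells T. \<Sum>f\<in>cell_faces T c. ?h c f) / 2"
      unfolding AW BW CW EW sum_cells_faces[OF faces axis] by (simp add: sum.distrib)
    also have "\<dots> = (M * ?W') $$ (i, j)"
      unfolding MW by (simp add: sum.distrib sum_divide_distrib)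
    finally show "((S + (1 / 2) \<cdot>\<^sub>m E) * ?W) $$ (i, j) = (M * ?W') $$ (i, j)" .
  qed (use carrier_matD[OF carr(4)] carrier_matD[OF carr(5)] carrier_matD[OF carr(6)] in
      \<open>simp_all add: vandermonde_def vandermonde_deriv_def\<close>)

  have boundary: "(?W\<^sup>T * E * ?W) $$ (i, j) =
      (LINT y:frontier (omega T)|surface_measure. V i y * V j y * outward_unit_normal (omega T) y $ k)"
    if ij: "i < ?K" "j < ?K" for i j
  proof -
    let ?h = "\<lambda>c f. ?F f c (?Vf f) (?Vf f) $$ (i, j)"
    have cell: "(\<Sum>f\<in>cell_faces T c. ?h c f) =
        (LINT y:frontier (cell T c)|surface_measure. V i y * V j y * outward_unit_normal (cell T c) y $ k)"
      if c: "c < n_cells T" for c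
    proof -
      obtain S0 E0 where S0: "S0 \<in> carrier_mat (?s c) (?s c)" and E0: "E0 \<in> carrier_mat (?s c) (?s c)"
        and Q0: "Qc c = S0 + (1 / 2) \<cdot>\<^sub>m E0" and sk: "skew_symmetric_mat S0" and sy: "symmetric_mat E0"
        and int: "((?Vc c)\<^sup>T * E0 * ?Vc c) $$ (i, j) = (LINT y:frontier (cell T c)|surface_measure.
            V i y * V j y * outward_unit_normal (cell T c) y $ k)"
        using cell_SBP[OF c] ij unfolding degenerate_SBP_pair_def by blast
      have Ecc: "Ec c \<in> carrier_mat (?s c) (?s c)" by (simp add: Ec[OF c])
      have "symmetric_mat (Ec c)"
        unfolding symmetric_mat_def Ec[OF c]
        by (rule transpose_mat_sum_face_form[OF Rc[OF c] Rc[OF c]])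
      \<comment> \<open>the matrix with the exact boundary integrals is the given sum of face terms\<close>
      then have "E0 = Ec c"
        using symmetric_part_unique[OF S0 cell_S_carrier[OF c] E0 Ecc sk cell_S_skew[OF c] sy]
          Q0 cell_Q[OF c] by simp
      have "(?Vc c)\<^sup>T * Ec c * ?Vc c = (?Vc c)\<^sup>T * (Ec c * ?Vc c)"
        by (rule congruence_assoc[OF vandermonde_carrier Ecc])
      also have "\<dots> = mat_sum ?K ?K (\<lambda>f. ?F f c (?Vf f) (?Vf f)) (cell_faces T c)"
        unfolding EcV[OF c]
        by (rule mult_mat_sum_face_form[OF Rc[OF c] vandermonde_carrier vandermonde_carrier
            R_cell_mult_vandermonde[OF rank[OF c]]])
      finally show ?thesis using int ij unfolding \<open>E0 = Ec c\<close> by simp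
    qed
    have opp: "?h (neg_cell T f) f + ?h (pos_cell T f) f = 0" if "f \<in> interfaces T" for f
      using face_form_opposite[OF axis that quad[OF that] vandermonde_carrier vandermonde_carrier ij] by simp
    have cont: "continuous_on UNIV (\<lambda>y. V i y * V j y)"
      using basis ij unfolding poly_basis_def
      by (intro continuous_on_mult continuous_on_poly_space[of _ p]) simp_all
    have "?W\<^sup>T * E * ?W = ?W\<^sup>T * (E * ?W)"
      by (rule congruence_assoc[OF vandermonde_carrier carr(5)])
    also have "E * ?W = mat_sum ?n ?K (\<lambda>f. ?F f (bdry_cell T f) (?R f (bdry_cell T f)) (?Vf f)) (bdry_faces T)"
      unfolding E'
      by (rule mat_sum_face_form_mult[OF R[OF bc] R[OF bc] vandermonde_carrier RW[OF bc]])
    also have "?W\<^sup>T * \<dots> = mat_sum ?K ?K (\<lambda>f. ?F f (bdry_cell T f) (?Vf f) (?Vf f)) (bdry_faces T)"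
      by (rule mult_mat_sum_face_form[OF R[OF bc] vandermonde_carrier vandermonde_carrier RW[OF bc]])
    finally have "(?W\<^sup>T * E * ?W) $$ (i, j) = (\<Sum>f\<in>bdry_faces T. ?h (bdry_cell T f) f)"
      using ij by simp
    \<comment> \<open>the interface terms that this adds cancel in pairs\<close>
    also have "\<dots> = (\<Sum>c<n_cells T. \<Sum>f\<in>cell_faces T c. ?h c f)"
      unfolding sum_cells_faces[OF faces axis] using opp by simp
    also have "\<dots> = (LINT y:frontier (omega T)|surface_measure. V i y * V j y * outward_unit_normal (omega T) y $ k)"
      using cell sum_cell_boundary_flux[OF mesh cont, of k] by simp
    finally show ?thesis .
  qed
  show ?thesis
    unfolding degenerate_SBP_pair_def
    using accuracy diagM symE skewS boundary carr(4-6)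
    by (intro conjI bexI[of _ S] bexI[of _ E]) simp_all
qed

end
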